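(* Let $H_{n,\ell}$ denote the number of tuples $(\tau_1,\dots,\tau_\ell)$ of transpositions in the symmetric group $\mathfrak S_n$ such that $\tau_1\tau_2\cdots\tau_\ell=\mathrm{id}$. Let $\theta>0$ and let $\ell=\ell(n)$ be even with $\ell\sim2\theta n$. Then as $n\to\infty$, $$H_{n,\ell}=\left(\frac{\ell}{\log n}\right)^{2\ell}\exp\big[(-2+\log2)\ell+o(n)\big],$$ where the $o(n)$ is uniform for $\ell/n$ in any compact subset of $(0,\infty)$.
   Context: $H_{n,\ell}$ equivalently counts (not necessarily connected) pure Hurwitz maps with $n$ vertices and $\ell$ edges, i.e. unconnected Hurwitz numbers. *)

theory Defs
  imports Complex_Main "HOL-Library.Landau_Symbols" "HOL-Combinatorics.Permutations"
begin

text \<open>Elements of the symmetric group on n letters are functions on nat that permute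
  {1..n} and fix every other number.\<close>

definition transpositions :: "nat \<Rightarrow> (nat \<Rightarrow> nat) set" where
  "transpositions n = {Transposition.transpose a b | a b. a \<in> {1..n} \<and> b \<in> {1..n} \<and> a \<noteq> b}"

definition hurwitz_number :: "nat \<Rightarrow> nat \<Rightarrow> nat" where
  "hurwitz_number n l =
     card {ts. length ts = l \<and> set ts \<subseteq> transpositions n \<and> foldr (\<circ>) ts id = id}"

end

theory Submission
  imports Defs "HOL-Analysis.Convex" "HOL-Real_Asymp.Real_Asymp"
begin

text \<open>
  Let \<open>A\<close> be the sum of all transpositions of \<open>{1..n}\<close>, acting by right translation on the real
  functions on the symmetric group. The number of factorisations of the identity is the value at
  the identity of \<open>A ^ l\<close> applied to the point mass there, i.e. the normalised trace of \<open>A ^ l\<close>.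

  The operator \<open>A\<close> is self-adjoint and commutes with all translations. Symmetrise an
  eigenfunction over the stabiliser of a colouring \<open>\<phi>\<close> whose sum of colours is minimal among those
  for which the result is nonzero. Moving a point to a smaller colour must give zero, which
  expresses the action of the transpositions across colour classes and forces the eigenvalue to be
  the sum of the numbers of pairs inside the classes minus the sum of the colours. (Up to the
  order of the colours this is the highest weight argument, and the eigenvalue is the content sum
  of a Young diagram.)

  Hence the eigenspace of a positive eigenvalue \<open>x\<close> embeds into the span of the coset indicators
  of the Young subgroups belonging to the large classes. If these cover \<open>M\<close> points, then \<open>x\<close> is at
  most about \<open>M\<^sup>2 / 2\<close>, and the dimension divided by \<open>n!\<close> is at most \<open>n\<close> to the power \<open>- M (1 - o(1))\<close>.
  Maximising \<open>(M\<^sup>2 / 2) ^ l\<close> times this bound gives \<open>M \<approx> 2 l / ln n\<close> and the upper estimate.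
  Negative eigenvalues are reduced to positive ones by multiplication with the sign.
  For the lower estimate, the constant functions alone show that there are at least
  \<open>(m choose 2) ^ l / m!\<close> factorisations on \<open>m\<close> letters; take \<open>m \<approx> 2 l / ln n\<close>.
\<close>

section \<open>Functions on the symmetric group\<close>

abbreviation tr :: "nat \<Rightarrow> nat \<Rightarrow> nat \<Rightarrow> nat" where
  "tr \<equiv> Transposition.transpose"

definition perms :: "nat \<Rightarrow> (nat \<Rightarrow> nat) set" where
  "perms n = {p. p permutes {1..n}}"

definition ip :: "nat \<Rightarrow> ((nat \<Rightarrow> nat) \<Rightarrow> real) \<Rightarrow> ((nat \<Rightarrow> nat) \<Rightarrow> real) \<Rightarrow> real" where
  "ip n f g = (\<Sum>s\<in>perms n. f s * g s)"

definition supported :: "nat \<Rightarrow> ((nat \<Rightarrow> nat) \<Rightarrow> real) \<Rightarrow> bool" where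
  "supported n f \<longleftrightarrow> (\<forall>s. s \<notin> perms n \<longrightarrow> f s = 0)"

definition walk :: "nat \<Rightarrow> ((nat \<Rightarrow> nat) \<Rightarrow> real) \<Rightarrow> (nat \<Rightarrow> nat) \<Rightarrow> real" where
  "walk n f s = (\<Sum>t\<in>transpositions n. f (s \<circ> t))"

text \<open>The zero function belongs to every \<open>x\<close>. Support in \<open>perms n\<close>
  turns identities on the group into identities at all \<open>s\<close>.\<close>

definition eigen :: "nat \<Rightarrow> real \<Rightarrow> ((nat \<Rightarrow> nat) \<Rightarrow> real) \<Rightarrow> bool" where
  "eigen n x f \<longleftrightarrow> supported n f \<and> (\<forall>s. walk n f s = x * f s)"

section \<open>Group laws in \<open>perms n\<close>\<close>

lemma finite_perms [simp]: "finite (perms n)"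
  unfolding perms_def by (rule finite_permutations) simp

lemma card_perms: "card (perms n) = fact n"
  unfolding perms_def by (rule card_permutations) auto

lemma id_perms [simp]: "id \<in> perms n"
  by (simp add: perms_def permutes_id)

lemma comp_perms [simp]: "s \<in> perms n \<Longrightarrow> t \<in> perms n \<Longrightarrow> s \<circ> t \<in> perms n"
  by (simp add: perms_def permutes_compose)

lemma inv_perms [simp]: "s \<in> perms n \<Longrightarrow> inv s \<in> perms n"
  by (simp add: perms_def permutes_inv)

lemma perms_inv_o [simp]:
  assumes "s \<in> perms n" shows "s \<circ> inv s = id" "inv s \<circ> s = id"
  using assms permutes_inv_o by (auto simp: perms_def)

lemma perms_inv_apply [simp]:
  assumes "s \<in> perms n" shows "s (inv s a) = a" "inv s (s a) = a"
  using assms permutes_inverses by (auto simp: perms_def)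

lemma perms_in_iff [simp]: "s \<in> perms n \<Longrightarrow> s a \<in> {1..n} \<longleftrightarrow> a \<in> {1..n}"
  using permutes_in_image by (fastforce simp: perms_def)

lemma perms_inj: "s \<in> perms n \<Longrightarrow> s a = s b \<longleftrightarrow> a = b"
  by (metis perms_inv_apply(2))

lemma perms_cancel [simp]:
  assumes "s \<in> perms n"
  shows "s \<circ> (inv s \<circ> t) = t" "inv s \<circ> (s \<circ> t) = t" "t \<circ> s \<circ> inv s = t" "t \<circ> inv s \<circ> s = t"
  using perms_inv_apply[OF assms] by (simp_all add: comp_def)

lemma comp_perms_right_iff [simp]: "t \<in> perms n \<Longrightarrow> s \<circ> t \<in> perms n \<longleftrightarrow> s \<in> perms n"
  using comp_perms[of "s \<circ> t" n "inv t"] by auto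

lemma comp_perms_left_iff [simp]: "s \<in> perms n \<Longrightarrow> s \<circ> t \<in> perms n \<longleftrightarrow> t \<in> perms n"
  using comp_perms[of "inv s" n "s \<circ> t"] comp_perms[of s n t] inv_perms[of s n] perms_cancel(2)[of s n t]
  by metis

lemma bij_betw_perms_right:
  assumes "t \<in> perms n" shows "bij_betw (\<lambda>s. s \<circ> t) (perms n) (perms n)"
  by (rule bij_betwI[where g = "\<lambda>s. s \<circ> inv t"]) (use assms in auto)

lemma bij_betw_perms_left:
  assumes "t \<in> perms n" shows "bij_betw (\<lambda>s. t \<circ> s) (perms n) (perms n)"
  by (rule bij_betwI[where g = "\<lambda>s. inv t \<circ> s"]) (use assms in auto)

lemma tr_perms [simp]: "a \<in> {1..n} \<Longrightarrow> b \<in> {1..n} \<Longrightarrow> tr a b \<in> perms n"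
  by (simp add: perms_def permutes_swap_id)

lemma transpositions_perms: "t \<in> transpositions n \<Longrightarrow> t \<in> perms n"
  unfolding transpositions_def using tr_perms by blast

lemma finite_transpositions [simp]: "finite (transpositions n)"
  using finite_subset[OF _ finite_perms] transpositions_perms by blast

lemma transpositions_involution: "t \<in> transpositions n \<Longrightarrow> t \<circ> t = id"
  by (auto simp: transpositions_def)

section \<open>The inner product and self-adjointness of \<open>walk\<close>\<close>

lemma ip_commute: "ip n f g = ip n g f"
  by (simp add: ip_def mult.commute)

lemma ip_sum_right: "ip n f (\<lambda>s. \<Sum>x\<in>X. g x s) = (\<Sum>x\<in>X. ip n f (g x))"
  unfolding ip_def by (simp add: sum_distrib_left) (rule sum.swap)

lemma ip_cmult_right: "ip n f (\<lambda>s. c * g s) = c * ip n f g"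
  unfolding ip_def by (simp add: sum_distrib_left algebra_simps)

lemma ip_diff_right: "ip n f (\<lambda>s. g s - h s) = ip n f g - ip n f h"
  unfolding ip_def by (simp add: sum_subtractf algebra_simps)

lemma ip_sum_left: "ip n (\<lambda>s. \<Sum>x\<in>X. g x s) f = (\<Sum>x\<in>X. ip n (g x) f)"
  by (simp add: ip_commute[of n _ f] ip_sum_right)

lemma ip_cmult_left: "ip n (\<lambda>s. c * g s) f = c * ip n g f"
  by (simp add: ip_commute[of n _ f] ip_cmult_right)

lemma ip_diff_left: "ip n (\<lambda>s. g s - h s) f = ip n g f - ip n h f"
  by (simp add: ip_commute[of n _ f] ip_diff_right)

lemma ip_ge_0: "ip n f f \<ge> 0"
  unfolding ip_def by (rule sum_nonneg) simp

lemma ip_eq_0_iff: "ip n f f = 0 \<longleftrightarrow> (\<forall>s\<in>perms n. f s = 0)"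
  unfolding ip_def by (subst sum_nonneg_eq_0_iff) auto

lemma ip_walk: "ip n (walk n f) g = ip n f (walk n g)"
proof -
  have "ip n (walk n f) g = (\<Sum>t\<in>transpositions n. \<Sum>s\<in>perms n. f (s \<circ> t) * g s)"
    unfolding ip_def walk_def sum_distrib_right by (rule sum.swap)
  also have "\<dots> = (\<Sum>t\<in>transpositions n. \<Sum>s\<in>perms n. f s * g (s \<circ> t))"
  proof (rule sum.cong[OF refl])
    fix t assume t: "t \<in> transpositions n"
    show "(\<Sum>s\<in>perms n. f (s \<circ> t) * g s) = (\<Sum>s\<in>perms n. f s * g (s \<circ> t))"
      by (subst sum.reindex_bij_betw[OF bij_betw_perms_right[OF transpositions_perms[OF t]], symmetric])
         (simp add: comp_assoc transpositions_involution[OF t])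
  qed
  also have "\<dots> = ip n f (walk n g)"
    unfolding ip_def walk_def sum_distrib_left by (rule sum.swap)
  finally show ?thesis .
qed

lemma eigen_orthogonal:
  assumes "eigen n x f" "eigen n y g" "x \<noteq> y"
  shows "ip n f g = 0"
proof -
  have "x * ip n f g = ip n (walk n f) g"
    using assms(1) by (simp add: eigen_def ip_def sum_distrib_left mult.assoc)
  also have "\<dots> = y * ip n f g"
    unfolding ip_walk using assms(2) by (simp add: eigen_def ip_def sum_distrib_left algebra_simps)
  finally show ?thesis using assms(3) by simp
qed

lemma supported_0_iff:
  "supported n f \<Longrightarrow> (\<forall>s\<in>perms n. f s = 0) \<longleftrightarrow> (\<forall>s. f s = 0)"
  by (auto simp: supported_def)

lemma supported_walk: "supported n f \<Longrightarrow> supported n (walk n f)"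
  by (auto simp: supported_def walk_def intro!: sum.neutral dest: transpositions_perms)

lemma walk_cmult: "walk n (\<lambda>s. c * f s) s = c * walk n f s"
  by (simp add: walk_def sum_distrib_left)

lemma walk_diff: "walk n (\<lambda>s. f s - g s) s = walk n f s - walk n g s"
  by (simp add: walk_def sum_subtractf)

lemma walk_sum: "walk n (\<lambda>s. \<Sum>x\<in>X. f x s) s = (\<Sum>x\<in>X. walk n (f x) s)"
  unfolding walk_def by (rule sum.swap)

lemma eigen_cmult: "eigen n x f \<Longrightarrow> eigen n x (\<lambda>s. c * f s)"
  by (auto simp: eigen_def supported_def walk_cmult)

lemma eigen_diff: "eigen n x f \<Longrightarrow> eigen n x g \<Longrightarrow> eigen n x (\<lambda>s. f s - g s)"
  by (auto simp: eigen_def supported_def walk_diff algebra_simps)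

lemma eigen_sum: "(\<And>i. i \<in> I \<Longrightarrow> eigen n x (f i)) \<Longrightarrow> eigen n x (\<lambda>s. \<Sum>i\<in>I. f i s)"
  by (auto simp: eigen_def supported_def walk_sum sum_distrib_left)

section \<open>Translations and pairs of points\<close>

lemma conj_tr:
  assumes "p \<in> perms n" shows "tr (p a) (p b) \<circ> p = p \<circ> tr a b"
proof
  fix x show "(tr (p a) (p b) \<circ> p) x = (p \<circ> tr a b) x"
    by (auto simp: Transposition.transpose_def perms_inj[OF assms])
qed

lemma conj_transpositions:
  assumes p: "p \<in> perms n"
  shows "bij_betw (\<lambda>t. inv p \<circ> t \<circ> p) (transpositions n) (transpositions n)"
proof -
  have *: "inv q \<circ> t \<circ> q \<in> transpositions n" if t: "t \<in> transpositions n" and q: "q \<in> perms n" for t q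
  proof -
    obtain a b where ab: "t = tr a b" "a \<in> {1..n}" "b \<in> {1..n}" "a \<noteq> b"
      using t by (auto simp: transpositions_def)
    have "inv q \<circ> t \<circ> q = tr (inv q a) (inv q b)"
      using conj_tr[OF inv_perms[OF q], of a b] ab q
      by (metis comp_assoc comp_id perms_inv_o(2))
    moreover have "inv q a \<in> {1..n}" "inv q b \<in> {1..n}"
      using ab inv_perms[OF q] by (metis perms_in_iff)+
    moreover have "inv q a \<noteq> inv q b"
      using ab q by (metis perms_inv_apply(1))
    ultimately show ?thesis unfolding transpositions_def by blast
  qed
  have inv2: "inv (inv p) = p"
    using p by (simp add: perms_def permutes_inv_inv)
  show ?thesis
  proof (rule bij_betwI[where g = "\<lambda>t. inv (inv p) \<circ> t \<circ> inv p"])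
    show "(\<lambda>t. inv p \<circ> t \<circ> p) \<in> transpositions n \<rightarrow> transpositions n"
      using * p by blast
    show "(\<lambda>t. inv (inv p) \<circ> t \<circ> inv p) \<in> transpositions n \<rightarrow> transpositions n"
      using * inv_perms[OF p] by blast
  qed (simp_all add: inv2 comp_def perms_inv_apply[OF p])
qed

text \<open>Moving \<open>p\<close> past a transposition conjugates it, and conjugation only
  permutes the transpositions.\<close>

lemma walk_translate:
  assumes p: "p \<in> perms n"
  shows "walk n (\<lambda>s. f (s \<circ> p)) s = walk n f (s \<circ> p)"
proof -
  have "walk n f (s \<circ> p) = (\<Sum>t\<in>transpositions n. f (s \<circ> p \<circ> (inv p \<circ> t \<circ> p)))"
    unfolding walk_def by (rule sum.reindex_bij_betw[OF conj_transpositions[OF p], symmetric])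
  also have "\<dots> = walk n (\<lambda>s. f (s \<circ> p)) s"
    unfolding walk_def
  proof (rule sum.cong[OF refl])
    fix t
    have "s \<circ> p \<circ> (inv p \<circ> t \<circ> p) = s \<circ> t \<circ> p"
      using perms_inv_apply(1)[OF p] by (simp add: comp_def)
    then show "f (s \<circ> p \<circ> (inv p \<circ> t \<circ> p)) = f (s \<circ> t \<circ> p)" by simp
  qed
  finally show ?thesis ..
qed

lemma tr_eq_iff:
  fixes a b c d :: nat
  assumes "a < b" "c < d" "tr a b = tr c d"
  shows "a = c \<and> b = d"
proof -
  have *: "{x. tr u v x \<noteq> x} = {u, v}" if "u < v" for u v :: nat
    using that by (auto simp: Transposition.transpose_def)
  have "{a, b} = {c, d}" using *[OF assms(1)] *[OF assms(2)] assms(3) by simp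
  then show ?thesis using assms by (auto simp: doubleton_eq_iff)
qed

text \<open>Each transposition comes from two ordered pairs. The ordered form can be split by
  comparing the colours of the two points.\<close>

lemma walk_pairs:
  "2 * walk n f s = (\<Sum>b\<in>{1..n}. \<Sum>a\<in>{1..n} - {b}. f (s \<circ> tr a b))"
proof -
  let ?L = "{(a, b). a \<in> {1..n} \<and> b \<in> {1..n} \<and> a < b}"
  let ?h = "\<lambda>(a, b). f (s \<circ> tr a b)"
  have finL: "finite ?L" by (rule finite_subset[of _ "{1..n} \<times> {1..n}"]) auto
  have T: "transpositions n = (\<lambda>(a, b). tr a b) ` ?L"
  proof (intro equalityI subsetI)
    fix t assume "t \<in> transpositions n"
    then obtain a b where ab: "t = tr a b" "a \<in> {1..n}" "b \<in> {1..n}" "a \<noteq> b"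
      by (auto simp: transpositions_def)
    show "t \<in> (\<lambda>(a, b). tr a b) ` ?L"
    proof (cases "a < b")
      case True
      then have "(a, b) \<in> ?L" using ab by auto
      then show ?thesis using ab by force
    next
      case False
      then have "(b, a) \<in> ?L" using ab by auto
      then show ?thesis using ab by (intro image_eqI[of _ _ "(b, a)"]) (auto simp: transpose_commute)
    qed
  next
    fix t assume "t \<in> (\<lambda>(a, b). tr a b) ` ?L"
    then show "t \<in> transpositions n" unfolding transpositions_def by force
  qed
  have inj: "inj_on (\<lambda>(a, b). tr a b) ?L"
    by (auto simp: inj_on_def dest: tr_eq_iff)
  have w: "walk n f s = sum ?h ?L"
    unfolding walk_def T by (subst sum.reindex[OF inj]) (simp add: case_prod_unfold)
  have sw: "sum ?h ((\<lambda>(a, b). (b, a)) ` ?L) = sum ?h ?L"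
    by (subst sum.reindex) (auto simp: inj_on_def transpose_commute intro!: sum.cong)
  have "(\<Sum>b\<in>{1..n}. \<Sum>a\<in>{1..n} - {b}. f (s \<circ> tr a b))
      = (\<Sum>(b, a)\<in>Sigma {1..n} (\<lambda>b. {1..n} - {b}). f (s \<circ> tr a b))"
    by (rule sum.Sigma) auto
  also have "\<dots> = (\<Sum>(b, a)\<in>Sigma {1..n} (\<lambda>b. {1..n} - {b}). f (s \<circ> tr b a))"
    by (simp add: transpose_commute)
  also have "Sigma {1..n} (\<lambda>b. {1..n} - {b}) = ?L \<union> (\<lambda>(a, b). (b, a)) ` ?L"
  proof (intro equalityI subsetI)
    fix x assume "x \<in> Sigma {1..n} (\<lambda>b. {1..n} - {b})"
    then obtain a b where "x = (a, b)" "a \<in> {1..n}" "b \<in> {1..n}" "a \<noteq> b" by blast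
    then show "x \<in> ?L \<union> (\<lambda>(a, b). (b, a)) ` ?L"
      by (cases "a < b") (auto intro!: image_eqI[of _ _ "(b, a)"])
  qed auto
  also have "(\<Sum>(b, a)\<in>\<dots>. f (s \<circ> tr b a)) = sum ?h ?L + sum ?h ((\<lambda>(a, b). (b, a)) ` ?L)"
    by (rule sum.union_disjoint) (use finL in auto)
  finally show ?thesis using w sw by linarith
qed

section \<open>Symmetrisation over colour stabilisers\<close>

text \<open>With \<open>n\<close> colours there is an injective colouring, whose stabiliser is
  trivial; extensionality keeps the set finite.\<close>

definition colourings :: "nat \<Rightarrow> (nat \<Rightarrow> nat) set" where
  "colourings n = {1..n} \<rightarrow>\<^sub>E {..<n}"

definition stab :: "nat \<Rightarrow> (nat \<Rightarrow> nat) \<Rightarrow> (nat \<Rightarrow> nat) set" where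
  "stab n \<phi> = {p \<in> perms n. \<forall>a\<in>{1..n}. \<phi> (p a) = \<phi> a}"

definition symmetrise :: "nat \<Rightarrow> (nat \<Rightarrow> nat) \<Rightarrow> ((nat \<Rightarrow> nat) \<Rightarrow> real) \<Rightarrow> (nat \<Rightarrow> nat) \<Rightarrow> real" where
  "symmetrise n \<phi> f s = (\<Sum>p\<in>stab n \<phi>. f (s \<circ> p))"

text \<open>If the classes are the rows of a Young diagram, numbered from \<open>0\<close>, this is
  the sum of column minus row over its cells.\<close>

definition content :: "nat \<Rightarrow> (nat \<Rightarrow> nat) \<Rightarrow> real" where
  "content n \<phi> = real (\<Sum>b\<in>{1..n}. card {a \<in> {1..n} - {b}. \<phi> a = \<phi> b}) / 2 - real (\<Sum>b\<in>{1..n}. \<phi> b)"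

lemma finite_colourings [simp]: "finite (colourings n)"
  unfolding colourings_def by (rule finite_PiE) auto

lemma finite_stab [simp]: "finite (stab n \<phi>)"
  by (rule finite_subset[OF _ finite_perms]) (auto simp: stab_def)

lemma stab_perms: "p \<in> stab n \<phi> \<Longrightarrow> p \<in> perms n"
  by (simp add: stab_def)

lemma stab_comp: "p \<in> stab n \<phi> \<Longrightarrow> q \<in> stab n \<phi> \<Longrightarrow> p \<circ> q \<in> stab n \<phi>"
  using perms_in_iff[of q n] by (auto simp: stab_def)

lemma stab_inv:
  assumes p: "p \<in> stab n \<phi>" shows "inv p \<in> stab n \<phi>"
proof -
  have P: "p \<in> perms n" using p by (rule stab_perms)
  have "\<phi> (inv p a) = \<phi> a" if "a \<in> {1..n}" for a
  proof -
    have "inv p a \<in> {1..n}" using perms_in_iff[OF inv_perms[OF P], of a] that by blast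
    then have "\<phi> (p (inv p a)) = \<phi> (inv p a)" using p unfolding stab_def by blast
    then show ?thesis by (simp add: perms_inv_apply[OF P])
  qed
  then show ?thesis using P by (simp add: stab_def)
qed

lemma bij_betw_stab_left:
  assumes "p \<in> stab n \<phi>" shows "bij_betw (\<lambda>s. p \<circ> s) (stab n \<phi>) (stab n \<phi>)"
  by (rule bij_betwI[where g = "\<lambda>s. inv p \<circ> s"])
     (use assms stab_perms[OF assms] in \<open>auto intro: stab_comp stab_inv\<close>)

lemma symmetrise_invariant:
  assumes "p \<in> stab n \<phi>" shows "symmetrise n \<phi> f (s \<circ> p) = symmetrise n \<phi> f s"
  unfolding symmetrise_def
  by (subst (2) sum.reindex_bij_betw[OF bij_betw_stab_left[OF assms], symmetric]) (simp add: comp_assoc)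

lemma symmetrise_walk: "symmetrise n \<phi> (walk n f) s = walk n (symmetrise n \<phi> f) s"
proof -
  have "walk n (symmetrise n \<phi> f) s = (\<Sum>p\<in>stab n \<phi>. walk n (\<lambda>s. f (s \<circ> p)) s)"
    unfolding symmetrise_def[abs_def] by (rule walk_sum)
  also have "\<dots> = symmetrise n \<phi> (walk n f) s"
    unfolding symmetrise_def by (intro sum.cong refl walk_translate stab_perms)
  finally show ?thesis ..
qed

text \<open>Both sides sum \<open>f\<close> over the coset of permutations \<open>(a b) \<circ> p = (c b) \<circ> q\<close>, where
  \<open>c\<close> is the preimage of \<open>b\<close> under \<open>p\<close>.\<close>

lemma symmetrise_move:
  assumes b: "b \<in> {1..n}" and i: "i < \<phi> b"
  shows "(\<Sum>a\<in>insert b {a \<in> {1..n}. \<phi> a = i}. symmetrise n \<phi> f (s \<circ> tr a b))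
       = (\<Sum>c\<in>{c \<in> {1..n}. \<phi> c = \<phi> b}. symmetrise n (\<phi>(c := i)) f (s \<circ> tr c b))"
proof -
  let ?A = "insert b {a \<in> {1..n}. \<phi> a = i}" and ?C = "{c \<in> {1..n}. \<phi> c = \<phi> b}"
  have "(\<Sum>a\<in>?A. symmetrise n \<phi> f (s \<circ> tr a b))
      = (\<Sum>(a, p)\<in>?A \<times> stab n \<phi>. f (s \<circ> (tr a b \<circ> p)))"
    unfolding symmetrise_def comp_assoc by (rule sum.cartesian_product)
  also have "\<dots> = (\<Sum>(c, q)\<in>Sigma ?C (\<lambda>c. stab n (\<phi>(c := i))). f (s \<circ> (tr c b \<circ> q)))"
  proof (rule sum.reindex_bij_witness[where
      j = "\<lambda>(a, p). (inv p b, tr (inv p b) b \<circ> (tr a b \<circ> p))" and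
      i = "\<lambda>(c, q). (tr c b (q c), tr (tr c b (q c)) b \<circ> (tr c b \<circ> q))"], goal_cases)
    case (1 x)
    then obtain a p where x: "x = (a, p)" "a \<in> ?A" "p \<in> stab n \<phi>" by auto
    have P: "p \<in> perms n" using x(3) by (rule stab_perms)
    show ?case unfolding x(1)
      by (auto simp: perms_inv_apply[OF P] fun_eq_iff)
  next
    case (2 x)
    then obtain a p where x: "x = (a, p)" "a \<in> ?A" "p \<in> stab n \<phi>" by auto
    have P: "p \<in> perms n" using x(3) by (rule stab_perms)
    define c where "c = inv p b"
    have pc: "p c = b" by (simp add: c_def perms_inv_apply[OF P])
    have c: "c \<in> {1..n}" using b pc perms_in_iff[OF P] by metis
    have \<phi>p: "\<phi> (p y) = \<phi> y" if "y \<in> {1..n}" for y using x(3) that unfolding stab_def by blast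
    have \<phi>c: "\<phi> c = \<phi> b" using \<phi>p[OF c] pc by simp
    have an: "a \<in> {1..n}" using x(2) b by auto
    have a: "a = b \<or> \<phi> a = i" using x(2) by auto
    have "tr c b \<circ> (tr a b \<circ> p) \<in> stab n (\<phi>(c := i))"
      unfolding stab_def
    proof (intro CollectI conjI ballI)
      show "tr c b \<circ> (tr a b \<circ> p) \<in> perms n" using P c b an by (intro comp_perms tr_perms)
      fix y assume y: "y \<in> {1..n}"
      show "(\<phi>(c := i)) ((tr c b \<circ> (tr a b \<circ> p)) y) = (\<phi>(c := i)) y"
      proof (cases "y = c")
        case True
        then show ?thesis using pc a \<phi>c i by (auto simp: Transposition.transpose_def)
      next
        case False
        then have "p y \<noteq> b" using pc perms_inj[OF P] by metis
        then consider "p y = a" "a \<noteq> b" | "p y \<noteq> a" "p y = c" "p y \<noteq> b" | "p y \<noteq> a" "p y \<noteq> c" "p y \<noteq> b"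
          by blast
        then show ?thesis
        proof cases
          case 1
          then show ?thesis using False \<phi>p[OF y] a by simp
        next
          case 2
          then show ?thesis using False \<phi>p[OF y] \<phi>c by simp
        next
          case 3
          then show ?thesis using False \<phi>p[OF y] by simp
        qed
      qed
    qed
    then show ?case unfolding x(1) using c \<phi>c by (simp add: c_def)
  next
    case (3 x)
    then obtain c q where x: "x = (c, q)" "c \<in> ?C" "q \<in> stab n (\<phi>(c := i))" by auto
    have Q: "q \<in> perms n" using x(3) by (rule stab_perms)
    define a where "a = tr c b (q c)"
    define p where "p = tr a b \<circ> (tr c b \<circ> q)"
    have cn: "c \<in> {1..n}" using x(2) by auto
    have "a \<in> {1..n}" using cn b Q perms_in_iff[OF Q] perms_in_iff[OF tr_perms[OF cn b]] a_def by metis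
    then have P: "p \<in> perms n" unfolding p_def using Q b cn by (intro comp_perms tr_perms)
    have "p c = b" by (simp add: p_def a_def)
    then have ip: "inv p b = c" using perms_inv_apply(2)[OF P] by metis
    show ?case unfolding x(1)
      by (simp add: ip flip: a_def p_def) (auto simp: p_def fun_eq_iff)
  next
    case (4 x)
    then obtain c q where x: "x = (c, q)" "c \<in> {1..n}" "\<phi> c = \<phi> b" "q \<in> stab n (\<phi>(c := i))" by auto
    have Q: "q \<in> perms n" using x(4) by (rule stab_perms)
    define a where "a = tr c b (q c)"
    have an: "a \<in> {1..n}" using x b Q perms_in_iff[OF Q] perms_in_iff[OF tr_perms[OF x(2) b]] a_def by metis
    have qq: "(\<phi>(c := i)) (q y) = (\<phi>(c := i)) y" if "y \<in> {1..n}" for y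
      using x(4) that unfolding stab_def by blast
    have "(\<phi>(c := i)) (q c) = i" using qq[OF x(2)] by simp
    then have a: "a = b \<or> \<phi> a = i \<and> a \<noteq> c"
      using i x(3) by (auto simp: a_def Transposition.transpose_def split: if_splits)
    have qc: "q c = tr c b a" by (simp add: a_def)
    have "tr a b \<circ> (tr c b \<circ> q) \<in> stab n \<phi>"
      unfolding stab_def
    proof (intro CollectI conjI ballI)
      show "tr a b \<circ> (tr c b \<circ> q) \<in> perms n" using Q x b an by (intro comp_perms tr_perms)
      fix y assume y: "y \<in> {1..n}"
      show "\<phi> ((tr a b \<circ> (tr c b \<circ> q)) y) = \<phi> y"
      proof (cases "y = c")
        case True
        then show ?thesis using qc x(3) by simp
      next
        case False
        then have ne: "q y \<noteq> q c" using perms_inj[OF Q] by metis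
        have "tr c b (q y) \<noteq> a" using ne qc by (metis transpose_involutory)
        then consider "q y = c" "a \<noteq> b" | "q y = b" "q y \<noteq> c" "c \<noteq> a" | "q y \<noteq> c" "q y \<noteq> b" "q y \<noteq> a"
          using ne qc by (cases "q y = c"; cases "q y = b") (auto simp: Transposition.transpose_def split: if_splits)
        then show ?thesis
        proof cases
          case 1
          then show ?thesis using False qq[OF y] a by simp
        next
          case 2
          then show ?thesis using False qq[OF y] x(3) by simp
        next
          case 3
          then show ?thesis using False qq[OF y] by simp
        qed
      qed
    qed
    then show ?case unfolding x(1) using an a by (auto simp: a_def)
  next
    case (5 x)
    then obtain a p where x: "x = (a, p)" by force
    show ?case unfolding x by (simp add: fun_eq_iff comp_def)
  qed
  also have "\<dots> = (\<Sum>c\<in>?C. symmetrise n (\<phi>(c := i)) f (s \<circ> tr c b))"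
    unfolding symmetrise_def comp_assoc by (rule sum.Sigma[symmetric]) auto
  finally show ?thesis .
qed

text \<open>Recolouring \<open>c\<close> from \<open>\<phi> b\<close> to \<open>i\<close> lowers the
  colour sum, so minimality kills the right-hand side of \<open>symmetrise_move\<close>. The swaps
  of \<open>b\<close> with any lower class then add up to minus the function, while swaps inside a
  class fix it.\<close>

lemma symmetrise_eigen:
  assumes \<phi>: "\<phi> \<in> colourings n"
    and min: "\<And>\<psi> s. \<psi> \<in> colourings n \<Longrightarrow> (\<Sum>b\<in>{1..n}. \<psi> b) < (\<Sum>b\<in>{1..n}. \<phi> b) \<Longrightarrow> symmetrise n \<psi> f s = 0"
  shows "walk n (symmetrise n \<phi> f) s = content n \<phi> * symmetrise n \<phi> f s"
proof -
  define g where "g = symmetrise n \<phi> f"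
  have cross: "(\<Sum>a\<in>{a \<in> {1..n}. \<phi> a = i}. g (s \<circ> tr a b)) = - g s"
    if b: "b \<in> {1..n}" and i: "i < \<phi> b" for b i
  proof -
    have "(\<Sum>a\<in>insert b {a \<in> {1..n}. \<phi> a = i}. g (s \<circ> tr a b)) = 0"
      unfolding g_def symmetrise_move[of b n i \<phi>, OF b i]
    proof (intro sum.neutral ballI min)
      fix c assume c: "c \<in> {c \<in> {1..n}. \<phi> c = \<phi> b}"
      have "\<phi> b < n" using \<phi> b by (auto simp: colourings_def)
      then show "\<phi>(c := i) \<in> colourings n" using \<phi> c i
        by (auto simp: colourings_def PiE_iff extensional_def)
      show "(\<Sum>b\<in>{1..n}. (\<phi>(c := i)) b) < (\<Sum>b\<in>{1..n}. \<phi> b)"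
        by (rule sum_strict_mono_ex1) (use c i in auto)
    qed
    moreover have "b \<notin> {a \<in> {1..n}. \<phi> a = i}" using i by auto
    ultimately show ?thesis by (subst (asm) sum.insert) (auto simp: algebra_simps)
  qed
  have same: "g (s \<circ> tr a b) = g s" if "a \<in> {1..n}" "b \<in> {1..n}" "\<phi> a = \<phi> b" for a b
    unfolding g_def
    by (rule symmetrise_invariant) (use that in \<open>auto simp: stab_def Transposition.transpose_def\<close>)
  \<comment> \<open>One summand \<open>- g s\<close> for each of the \<open>\<phi> b\<close> lower
    colours. Empty classes are included: for them \<open>cross\<close> forces
    \<open>g s = 0\<close>.\<close>
  have up: "(\<Sum>a\<in>{a \<in> {1..n}. \<phi> a < \<phi> b}. g (s \<circ> tr a b)) = - (real (\<phi> b) * g s)" if b: "b \<in> {1..n}" for b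
  proof -
    have "(\<Sum>a\<in>{a \<in> {1..n}. \<phi> a < \<phi> b}. g (s \<circ> tr a b))
        = (\<Sum>i\<in>{..<\<phi> b}. \<Sum>a\<in>{a \<in> {a \<in> {1..n}. \<phi> a < \<phi> b}. \<phi> a = i}. g (s \<circ> tr a b))"
      by (rule sum.group[symmetric]) auto
    also have "\<dots> = (\<Sum>i\<in>{..<\<phi> b}. \<Sum>a\<in>{a \<in> {1..n}. \<phi> a = i}. g (s \<circ> tr a b))"
      by (intro sum.cong refl) auto
    also have "\<dots> = (\<Sum>i\<in>{..<\<phi> b}. - g s)"
      by (intro sum.cong refl cross b) auto
    finally show ?thesis by simp
  qed
  \<comment> \<open>Reversing the pair lets every cross pair be counted at its point of higher
    colour.\<close>
  have sym: "(\<Sum>b\<in>{1..n}. \<Sum>a\<in>{a \<in> {1..n}. \<phi> a > \<phi> b}. g (s \<circ> tr a b))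
      = (\<Sum>b\<in>{1..n}. \<Sum>a\<in>{a \<in> {1..n}. \<phi> a < \<phi> b}. g (s \<circ> tr a b))"
    by (subst sum.swap_restrict) (auto simp: transpose_commute intro!: sum.cong)
  have "2 * walk n g s = (\<Sum>b\<in>{1..n}. \<Sum>a\<in>{1..n} - {b}. g (s \<circ> tr a b))"
    by (rule walk_pairs)
  also have "\<dots> = (\<Sum>b\<in>{1..n}. (\<Sum>a\<in>{a \<in> {1..n} - {b}. \<phi> a = \<phi> b}. g (s \<circ> tr a b))
      + (\<Sum>a\<in>{a \<in> {1..n}. \<phi> a < \<phi> b}. g (s \<circ> tr a b)) + (\<Sum>a\<in>{a \<in> {1..n}. \<phi> a > \<phi> b}. g (s \<circ> tr a b)))"
  proof (rule sum.cong[OF refl])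
    fix b
    have D: "{1..n} - {b} = ({a \<in> {1..n} - {b}. \<phi> a = \<phi> b} \<union> {a \<in> {1..n}. \<phi> a < \<phi> b}) \<union> {a \<in> {1..n}. \<phi> a > \<phi> b}"
      by auto
    show "(\<Sum>a\<in>{1..n} - {b}. g (s \<circ> tr a b)) = (\<Sum>a\<in>{a \<in> {1..n} - {b}. \<phi> a = \<phi> b}. g (s \<circ> tr a b))
      + (\<Sum>a\<in>{a \<in> {1..n}. \<phi> a < \<phi> b}. g (s \<circ> tr a b)) + (\<Sum>a\<in>{a \<in> {1..n}. \<phi> a > \<phi> b}. g (s \<circ> tr a b))"
      by (subst D) (subst sum.union_disjoint; (force simp: sum.union_disjoint)?)+
  qed
  also have "\<dots> = (\<Sum>b\<in>{1..n}. real (card {a \<in> {1..n} - {b}. \<phi> a = \<phi> b}) * g s)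
      + 2 * (\<Sum>b\<in>{1..n}. - (real (\<phi> b) * g s))"
  proof -
    have "(\<Sum>a\<in>{a \<in> {1..n} - {b}. \<phi> a = \<phi> b}. g (s \<circ> tr a b))
        = real (card {a \<in> {1..n} - {b}. \<phi> a = \<phi> b}) * g s" if "b \<in> {1..n}" for b
    proof -
      have "(\<Sum>a\<in>{a \<in> {1..n} - {b}. \<phi> a = \<phi> b}. g (s \<circ> tr a b))
          = (\<Sum>a\<in>{a \<in> {1..n} - {b}. \<phi> a = \<phi> b}. g s)"
        by (intro sum.cong refl same) (use that in auto)
      then show ?thesis by simp
    qed
    then show ?thesis using up unfolding sum.distrib sym by simp
  qed
  finally have "2 * walk n g s = 2 * (content n \<phi> * g s)"
    unfolding content_def by (simp add: sum_negf flip: sum_distrib_right) (simp add: field_simps)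
  then show ?thesis by (simp add: g_def)
qed

section \<open>Spectral decomposition\<close>

definition spec :: "nat \<Rightarrow> real set" where
  "spec n = content n ` colourings n"

definition point :: "(nat \<Rightarrow> nat) \<Rightarrow> (nat \<Rightarrow> nat) \<Rightarrow> real" where
  "point s t = (if t = s then 1 else 0)"

lemma finite_spec [simp]: "finite (spec n)"
  by (simp add: spec_def)

section \<open>Minimal colourings and diagonalisation\<close>

lemma symmetrise_nonzero_ex:
  assumes f: "supported n f" "f s \<noteq> 0"
  shows "\<exists>\<phi>\<in>colourings n. \<exists>s. symmetrise n \<phi> f s \<noteq> 0"
proof
  \<comment> \<open>An injective colouring has trivial stabiliser, so symmetrising returns
    \<open>f\<close>; the shift by one makes the colours start at \<open>0\<close>.\<close>
  define \<phi> where "\<phi> = (\<lambda>b\<in>{1..n}. b - 1)"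
  show "\<phi> \<in> colourings n" by (auto simp: \<phi>_def colourings_def)
  have "stab n \<phi> = {id}"
  proof (intro equalityI subsetI)
    fix p assume p: "p \<in> stab n \<phi>"
    then have P: "p permutes {1..n}" by (auto simp: stab_def perms_def)
    have "p a = a" for a
    proof (cases "a \<in> {1..n}")
      case True
      then have "\<phi> (p a) = \<phi> a" "p a \<in> {1..n}" using p perms_in_iff[of p n a] by (auto simp: stab_def)
      then show ?thesis using True by (auto simp: \<phi>_def)
    qed (use P in \<open>simp add: permutes_not_in\<close>)
    then show "p \<in> {id}" by auto
  qed (auto simp: stab_def)
  then have "symmetrise n \<phi> f s = f s" by (simp add: symmetrise_def)
  then show "\<exists>s. symmetrise n \<phi> f s \<noteq> 0" using f by metis
qed

lemma minimal_colouring: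
  assumes "\<exists>\<phi>\<in>colourings n. \<exists>s. symmetrise n \<phi> f s \<noteq> 0"
  obtains \<phi> s where "\<phi> \<in> colourings n" "symmetrise n \<phi> f s \<noteq> 0"
    "\<And>\<psi> s. \<psi> \<in> colourings n \<Longrightarrow> (\<Sum>b\<in>{1..n}. \<psi> b) < (\<Sum>b\<in>{1..n}. \<phi> b) \<Longrightarrow> symmetrise n \<psi> f s = 0"
proof -
  let ?P = "\<lambda>\<phi>. \<phi> \<in> colourings n \<and> (\<exists>s. symmetrise n \<phi> f s \<noteq> 0)"
  obtain \<phi> where "?P \<phi>" "\<And>\<psi>. ?P \<psi> \<Longrightarrow> (\<Sum>b\<in>{1..n}. \<phi> b) \<le> (\<Sum>b\<in>{1..n}. \<psi> b)"
    using ex_has_least_nat[of ?P _ "\<lambda>\<phi>. \<Sum>b\<in>{1..n}. \<phi> b"] assms by metis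
  then show thesis using that by (metis not_le)
qed

text \<open>Since \<open>symmetrise\<close> commutes with \<open>walk\<close>, the nonzero
  symmetrisation at a minimal colouring is multiplied both by \<open>x\<close> and by the
  content.\<close>

lemma eigenvalue_content:
  assumes f: "eigen n x f" "f s \<noteq> 0"
  shows "\<exists>\<phi>\<in>colourings n. content n \<phi> = x \<and> (\<exists>s. symmetrise n \<phi> f s \<noteq> 0)"
proof -
  have "\<exists>\<phi>\<in>colourings n. \<exists>s. symmetrise n \<phi> f s \<noteq> 0"
    using f by (intro symmetrise_nonzero_ex) (auto simp: eigen_def)
  then obtain \<phi> s where \<phi>: "\<phi> \<in> colourings n" "symmetrise n \<phi> f s \<noteq> 0"
    "\<And>\<psi> s. \<psi> \<in> colourings n \<Longrightarrow> (\<Sum>b\<in>{1..n}. \<psi> b) < (\<Sum>b\<in>{1..n}. \<phi> b) \<Longrightarrow> symmetrise n \<psi> f s = 0"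
    by (rule minimal_colouring) blast
  have "walk n f = (\<lambda>s. x * f s)" using f by (auto simp: eigen_def)
  then have "x * symmetrise n \<phi> f s = symmetrise n \<phi> (walk n f) s"
    by (simp add: symmetrise_def sum_distrib_left)
  also have "\<dots> = content n \<phi> * symmetrise n \<phi> f s"
    unfolding symmetrise_walk using \<phi>(1,3) by (rule symmetrise_eigen)
  finally show ?thesis using \<phi> by auto
qed

text \<open>Induction on the number of colourings that do not annihilate \<open>f\<close>. If
  \<open>c\<close> is the content of a minimal one, \<open>walk n - c\<close> annihilates that
  symmetrisation and revives no other; the components of the image are then divided by
  \<open>x - c\<close>.\<close>

lemma eigen_decomposition:
  assumes "supported n f"
  shows "\<exists>F. (\<forall>x\<in>spec n. eigen n x (F x)) \<and> (\<forall>s. f s = (\<Sum>x\<in>spec n. F x s))"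
  using assms
proof (induction "card {\<phi> \<in> colourings n. \<exists>s. symmetrise n \<phi> f s \<noteq> 0}" arbitrary: f rule: less_induct)
  case less
  note f = less.prems
  show ?case
  proof (cases "\<exists>\<phi>\<in>colourings n. \<exists>s. symmetrise n \<phi> f s \<noteq> 0")
    case False
    then have "f s = 0" for s using symmetrise_nonzero_ex[OF f] by blast
    then show ?thesis
      by (intro exI[of _ "\<lambda>x s. 0"]) (auto simp: eigen_def supported_def walk_def)
  next
    case True
    then obtain \<phi> s0 where \<phi>: "\<phi> \<in> colourings n" "symmetrise n \<phi> f s0 \<noteq> 0"
      "\<And>\<psi> s. \<psi> \<in> colourings n \<Longrightarrow> (\<Sum>b\<in>{1..n}. \<psi> b) < (\<Sum>b\<in>{1..n}. \<phi> b) \<Longrightarrow> symmetrise n \<psi> f s = 0"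
      by (rule minimal_colouring) blast
    define c where "c = content n \<phi>"
    have cs: "c \<in> spec n" using \<phi>(1) by (simp add: c_def spec_def)
    define g where "g = (\<lambda>s. walk n f s - c * f s)"
    have gsup: "supported n g"
      using f supported_walk[OF f] by (simp add: g_def supported_def)
    have sg: "symmetrise n \<psi> g s = walk n (symmetrise n \<psi> f) s - c * symmetrise n \<psi> f s" for \<psi> s
    proof -
      have "symmetrise n \<psi> g s = symmetrise n \<psi> (walk n f) s - c * symmetrise n \<psi> f s"
        by (simp add: symmetrise_def g_def sum_subtractf sum_distrib_left)
      then show ?thesis by (simp add: symmetrise_walk)
    qed
    have "symmetrise n \<phi> g s = 0" for s
      unfolding sg using symmetrise_eigen[OF \<phi>(1,3)] by (simp add: c_def)
    moreover have "symmetrise n \<psi> g s = 0" if "\<forall>s. symmetrise n \<psi> f s = 0" for \<psi> s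
      unfolding sg using that by (simp add: walk_def)
    ultimately have "{\<psi> \<in> colourings n. \<exists>s. symmetrise n \<psi> g s \<noteq> 0}
        \<subset> {\<psi> \<in> colourings n. \<exists>s. symmetrise n \<psi> f s \<noteq> 0}"
      using \<phi>(1,2) by blast
    then have "card {\<psi> \<in> colourings n. \<exists>s. symmetrise n \<psi> g s \<noteq> 0}
        < card {\<psi> \<in> colourings n. \<exists>s. symmetrise n \<psi> f s \<noteq> 0}"
      by (intro psubset_card_mono) auto
    from less.hyps[OF this gsup] obtain G where
      G: "\<And>x. x \<in> spec n \<Longrightarrow> eigen n x (G x)" "\<And>s. g s = (\<Sum>x\<in>spec n. G x s)" by metis
    text \<open>The component of \<open>g\<close> in the kernel of \<open>walk n - c\<close> vanishes because \<open>g\<close> lies in the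
      range of this self-adjoint operator.\<close>
    have "ip n (G c) (G c) = (\<Sum>x\<in>spec n. ip n (G c) (G x))"
    proof -
      have "(\<Sum>x\<in>spec n. ip n (G c) (G x)) = ip n (G c) (G c) + (\<Sum>x\<in>spec n - {c}. ip n (G c) (G x))"
        by (rule sum.remove) (use cs in auto)
      also have "(\<Sum>x\<in>spec n - {c}. ip n (G c) (G x)) = 0"
        by (intro sum.neutral ballI eigen_orthogonal[OF G(1)[OF cs] G(1)]) auto
      finally show ?thesis by simp
    qed
    also have "\<dots> = ip n (G c) g"
      by (simp add: G(2)[abs_def] ip_sum_right)
    also have "\<dots> = ip n (G c) (walk n f) - c * ip n (G c) f"
      unfolding g_def by (simp add: ip_diff_right ip_cmult_right)
    also have "ip n (G c) (walk n f) = c * ip n (G c) f"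
      unfolding ip_walk[symmetric] using G(1)[OF cs]
      by (simp add: eigen_def ip_def sum_distrib_left mult.assoc)
    finally have "ip n (G c) (G c) = 0" by simp
    then have Gc: "G c s = 0" for s
      using G(1)[OF cs] supported_0_iff unfolding ip_eq_0_iff eigen_def by blast
    \<comment> \<open>Applying \<open>walk n - c\<close> to the remainder \<open>F c\<close> leaves
      \<open>g\<close> minus all \<open>G y\<close> with \<open>y \<noteq> c\<close>, which is
      \<open>G c = 0\<close>.\<close>
    define F where "F = (\<lambda>x s. if x = c then f s - (\<Sum>y\<in>spec n - {c}. 1 / (y - c) * G y s) else 1 / (x - c) * G x s)"
    have "eigen n x (F x)" if x: "x \<in> spec n" for x
    proof (cases "x = c")
      case False
      then show ?thesis using eigen_cmult[OF G(1)[OF x], of "1 / (x - c)"] by (simp add: F_def)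
    next
      case True
      have "walk n (F c) s = c * F c s" for s
      proof -
        have "walk n (F c) s = walk n f s - (\<Sum>y\<in>spec n - {c}. 1 / (y - c) * walk n (G y) s)"
          by (simp only: F_def walk_diff walk_sum walk_cmult simp_thms if_True)
        also have "(\<Sum>y\<in>spec n - {c}. 1 / (y - c) * walk n (G y) s)
            = (\<Sum>y\<in>spec n - {c}. c * (1 / (y - c) * G y s) + G y s)"
        proof (rule sum.cong[OF refl])
          fix y assume y: "y \<in> spec n - {c}"
          then have "walk n (G y) s = y * G y s" using G(1)[of y] by (auto simp: eigen_def)
          then show "1 / (y - c) * walk n (G y) s = c * (1 / (y - c) * G y s) + G y s"
            using y by (simp add: field_simps)
        qed
        also have "\<dots> = c * (\<Sum>y\<in>spec n - {c}. 1 / (y - c) * G y s) + (\<Sum>y\<in>spec n - {c}. G y s)"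
          by (simp add: sum.distrib sum_distrib_left)
        also have "(\<Sum>y\<in>spec n - {c}. G y s) = g s"
          unfolding G(2) by (subst sum.remove[OF finite_spec cs]) (simp add: Gc)
        finally show ?thesis by (simp add: F_def g_def algebra_simps)
      qed
      moreover have "supported n (F c)"
        unfolding supported_def
      proof (intro allI impI)
        fix s assume s: "s \<notin> perms n"
        have "G y s = 0" if "y \<in> spec n" for y using G(1)[OF that] s by (auto simp: eigen_def supported_def)
        then show "F c s = 0" using f s by (simp add: F_def supported_def)
      qed
      ultimately show ?thesis using True by (simp add: eigen_def)
    qed
    moreover have "f s = (\<Sum>x\<in>spec n. F x s)" for s
    proof -
      have "(\<Sum>x\<in>spec n. F x s) = F c s + (\<Sum>x\<in>spec n - {c}. F x s)"
        by (rule sum.remove) (use cs in auto)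
      also have "(\<Sum>x\<in>spec n - {c}. F x s) = (\<Sum>y\<in>spec n - {c}. 1 / (y - c) * G y s)"
        by (intro sum.cong refl) (auto simp: F_def)
      finally show ?thesis by (simp add: F_def)
    qed
    ultimately show ?thesis by blast
  qed
qed

section \<open>The point mass and the trace formula\<close>

lemma supported_point: "s \<in> perms n \<Longrightarrow> supported n (point s)"
  by (auto simp: supported_def point_def)

lemma ip_point: "s \<in> perms n \<Longrightarrow> ip n f (point s) = f s"
  by (simp add: ip_def point_def if_distrib cong: if_cong)

text \<open>The start \<open>s\<close> is left free for the induction: the first transposition of a
  tuple is absorbed into it, which is one step of \<open>walk\<close>.\<close>

lemma funpow_walk_point:
  "(walk n ^^ l) (point id) s
    = real (card {ts. length ts = l \<and> set ts \<subseteq> transpositions n \<and> s \<circ> foldr (\<circ>) ts id = id})"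
proof (induction l arbitrary: s)
  case 0
  have "{ts :: (nat \<Rightarrow> nat) list. length ts = 0 \<and> set ts \<subseteq> transpositions n \<and> s \<circ> foldr (\<circ>) ts id = id}
      = (if s = id then {[]} else {})" by auto
  then have "card {ts :: (nat \<Rightarrow> nat) list. length ts = 0 \<and> set ts \<subseteq> transpositions n \<and> s \<circ> foldr (\<circ>) ts id = id}
      = (if s = id then 1 else 0)" by (simp only: card.empty card_1_singleton_iff split: if_splits) auto
  then show ?case unfolding point_def funpow_0 by (simp only: split: if_splits) auto
next
  case (Suc l)
  let ?S = "\<lambda>s. {ts. length ts = l \<and> set ts \<subseteq> transpositions n \<and> s \<circ> foldr (\<circ>) ts id = id}"
  have fin: "finite (?S s)" for s
    by (rule finite_subset[OF _ finite_lists_length_eq[OF finite_transpositions, of n l]]) auto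
  have eq: "{ts. length ts = Suc l \<and> set ts \<subseteq> transpositions n \<and> s \<circ> foldr (\<circ>) ts id = id}
      = (\<Union>t\<in>transpositions n. (\<lambda>ts. t # ts) ` ?S (s \<circ> t))"
    (is "?L = ?R")
  proof (intro equalityI subsetI)
    fix ts assume "ts \<in> ?L"
    then show "ts \<in> ?R" by (cases ts) (auto simp: comp_assoc)
  qed (auto simp: comp_assoc)
  have "card ?L = (\<Sum>t\<in>transpositions n. card ((\<lambda>ts. t # ts) ` ?S (s \<circ> t)))"
    unfolding eq by (rule card_UN_disjoint) (use fin in auto)
  also have "\<dots> = (\<Sum>t\<in>transpositions n. card (?S (s \<circ> t)))"
    by (intro sum.cong refl card_image) auto
  finally have "real (card ?L) = (\<Sum>t\<in>transpositions n. real (card (?S (s \<circ> t))))"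
    by (simp only: of_nat_sum)
  also have "\<dots> = walk n ((walk n ^^ l) (point id)) s"
    unfolding walk_def Suc.IH ..
  also have "\<dots> = (walk n ^^ Suc l) (point id) s" by simp
  finally show ?case ..
qed

lemma funpow_walk_eigen:
  "eigen n x f \<Longrightarrow> (walk n ^^ l) f s = x ^ l * f s"
proof (induction l arbitrary: s)
  case (Suc l)
  then have "(walk n ^^ l) f = (\<lambda>s. x ^ l * f s)" by auto
  then show ?case using Suc.prems by (simp add: walk_cmult eigen_def)
qed simp

lemma funpow_walk_sum:
  "(walk n ^^ l) (\<lambda>s. \<Sum>x\<in>X. f x s) s = (\<Sum>x\<in>X. (walk n ^^ l) (f x) s)"
proof (induction l arbitrary: s)
  case (Suc l)
  then have "(walk n ^^ l) (\<lambda>s. \<Sum>x\<in>X. f x s) = (\<lambda>s. \<Sum>x\<in>X. (walk n ^^ l) (f x) s)" by auto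
  then show ?case by (simp add: walk_sum)
qed simp

text \<open>For \<open>x\<close> in \<open>spec n\<close>, the orthogonal projection of the point
  mass at the identity to the eigenspace of \<open>x\<close>; orthogonality makes it unique.\<close>

definition point_component :: "nat \<Rightarrow> real \<Rightarrow> (nat \<Rightarrow> nat) \<Rightarrow> real" where
  "point_component n = (SOME F. (\<forall>x\<in>spec n. eigen n x (F x)) \<and> (\<forall>s. point id s = (\<Sum>x\<in>spec n. F x s)))"

lemma point_component:
  "x \<in> spec n \<Longrightarrow> eigen n x (point_component n x)"
  "point id s = (\<Sum>x\<in>spec n. point_component n x s)"
  using someI_ex[OF eigen_decomposition[OF supported_point[OF id_perms]]]
  unfolding point_component_def by blast+

lemma hurwitz_number_spectral:
  "real (hurwitz_number n l) = (\<Sum>x\<in>spec n. x ^ l * point_component n x id)"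
proof -
  have "real (hurwitz_number n l) = (walk n ^^ l) (point id) id"
    by (simp add: funpow_walk_point hurwitz_number_def)
  also have "point id = (\<lambda>s. \<Sum>x\<in>spec n. point_component n x s)"
    using point_component(2) by blast
  also have "(walk n ^^ l) \<dots> id = (\<Sum>x\<in>spec n. x ^ l * point_component n x id)"
    unfolding funpow_walk_sum by (intro sum.cong refl funpow_walk_eigen point_component)
  finally show ?thesis .
qed

section \<open>Projections and multiplicities\<close>

lemma ip_component:
  assumes F: "\<And>y. y \<in> spec n \<Longrightarrow> eigen n y (F y)" "\<And>s. f s = (\<Sum>y\<in>spec n. F y s)"
    and x: "x \<in> spec n" and g: "eigen n x g"
  shows "ip n g f = ip n g (F x)"
proof -
  have "f = (\<lambda>s. \<Sum>y\<in>spec n. F y s)" using F(2) by blast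
  then have "ip n g f = (\<Sum>y\<in>spec n. ip n g (F y))"
    by (simp add: ip_sum_right)
  also have "\<dots> = ip n g (F x) + (\<Sum>y\<in>spec n - {x}. ip n g (F y))"
    by (rule sum.remove) (use x in auto)
  also have "(\<Sum>y\<in>spec n - {x}. ip n g (F y)) = 0"
    by (intro sum.neutral ballI eigen_orthogonal[OF g F(1)]) auto
  finally show ?thesis by simp
qed

text \<open>Pairing with the point mass evaluates at the identity, and among the components only the
  one at \<open>x\<close> contributes. The value is thus a squared norm.\<close>

lemma point_component_id:
  assumes "x \<in> spec n"
  shows "point_component n x id = ip n (point_component n x) (point_component n x)"
  using ip_component[OF point_component assms point_component(1)[OF assms]] by (simp add: ip_point)

lemma point_component_nonneg: "x \<in> spec n \<Longrightarrow> point_component n x id \<ge> 0"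
  by (simp add: point_component_id ip_ge_0)

text \<open>The last clause stands in for spanning: whatever is orthogonal to the orthonormal family
  is orthogonal to every \<open>w u\<close>. Residuals of norm zero are dropped, so \<open>k\<close>
  may be smaller than \<open>card U\<close>.\<close>

lemma gram_schmidt:
  assumes "finite U" "\<And>u. u \<in> U \<Longrightarrow> eigen n x (w u)"
  shows "\<exists>k v. k \<le> card U \<and> (\<forall>i<k. eigen n x (v i)) \<and>
    (\<forall>i<k. \<forall>j<k. ip n (v i) (v j) = (if i = j then 1 else 0)) \<and>
    (\<forall>f. (\<forall>i<k. ip n f (v i) = 0) \<longrightarrow> (\<forall>u\<in>U. ip n f (w u) = 0))"
  using assms
proof (induction U rule: finite_induct)
  case empty
  then show ?case by auto
next
  case (insert u U)
  then obtain k :: nat and v where k: "k \<le> card U" and v: "\<forall>i<k. eigen n x (v i)"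
    and on: "\<forall>i<k. \<forall>j<k. ip n (v i) (v j) = (if i = j then 1 else 0)"
    and perp: "\<forall>f. (\<forall>i<k. ip n f (v i) = 0) \<longrightarrow> (\<forall>u\<in>U. ip n f (w u) = 0)"
    by auto
  define h where "h = (\<lambda>s. w u s - (\<Sum>i<k. ip n (w u) (v i) * v i s))"
  have h: "eigen n x h"
    unfolding h_def by (intro eigen_diff eigen_sum eigen_cmult) (use insert v in auto)
  have iph: "ip n f h = ip n f (w u) - (\<Sum>i<k. ip n (w u) (v i) * ip n f (v i))" for f
    unfolding h_def by (simp add: ip_diff_right ip_sum_right ip_cmult_right)
  have hv: "ip n (v j) h = 0" if "j < k" for j
  proof -
    have "(\<Sum>i<k. ip n (w u) (v i) * ip n (v j) (v i)) = (\<Sum>i<k. if i = j then ip n (w u) (v i) else 0)"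
      by (intro sum.cong refl) (use on that in auto)
    then show ?thesis unfolding iph using that by (simp add: ip_commute)
  qed
  show ?case
  proof (cases "ip n h h = 0")
    case True
    then have "ip n f h = 0" for f unfolding ip_eq_0_iff by (simp add: ip_def)
    then have "ip n f (w u) = 0" if "\<forall>i<k. ip n f (v i) = 0" for f
      using iph[of f] that by simp
    then show ?thesis using k v on perp insert
      by (intro exI[of _ k] exI[of _ v]) auto
  next
    case False
    define N where "N = sqrt (ip n h h)"
    have N: "N > 0" "N * N = ip n h h" using False ip_ge_0[of n h] by (auto simp: N_def)
    define v' where "v' = (\<lambda>i. if i = k then (\<lambda>s. 1 / N * h s) else v i)"
    have "eigen n x (v' i)" if "i < Suc k" for i
      using that v eigen_cmult[OF h, of "1 / N"] by (auto simp: v'_def less_Suc_eq)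
    moreover have "ip n (v' i) (v' j) = (if i = j then 1 else 0)" if "i < Suc k" "j < Suc k" for i j
    proof -
      have "ip n (\<lambda>s. 1 / N * h s) (\<lambda>s. 1 / N * h s) = 1"
        unfolding ip_cmult_left ip_cmult_right using N False by (simp add: field_simps)
      moreover have "ip n (v i) (\<lambda>s. 1 / N * h s) = 0" "ip n (\<lambda>s. 1 / N * h s) (v i) = 0" if "i < k" for i
        unfolding ip_cmult_left ip_cmult_right using hv[OF that] by (simp_all add: ip_commute)
      ultimately show ?thesis using on that by (auto simp: v'_def less_Suc_eq)
    qed
    moreover have "\<forall>u'\<in>insert u U. ip n f (w u') = 0" if f: "\<forall>i<Suc k. ip n f (v' i) = 0" for f
    proof -
      have fv: "ip n f (v i) = 0" if "i < k" for i
        using f[rule_format, of i] that by (auto simp: v'_def)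
      have "ip n f (\<lambda>s. 1 / N * h s) = 0" using f[rule_format, of k] by (simp add: v'_def)
      then have "ip n f h = 0" unfolding ip_cmult_right using N by simp
      then have "ip n f (w u) = 0" using iph[of f] fv by simp
      then show ?thesis using perp fv by auto
    qed
    ultimately show ?thesis using k insert
      by (intro exI[of _ "Suc k"] exI[of _ v']) auto
  qed
qed

text \<open>The left-hand side is the dimension of the eigenspace: the left translates of
  \<open>point_component n x\<close> form the kernel of the orthogonal projection onto it.\<close>

lemma fact_point_component_le:
  assumes x: "x \<in> spec n" and U: "finite U" "\<And>u. u \<in> U \<Longrightarrow> supported n u"
    and sep: "\<And>f. eigen n x f \<Longrightarrow> (\<forall>u\<in>U. ip n f u = 0) \<Longrightarrow> \<forall>s. f s = 0"
  shows "fact n * point_component n x id \<le> real (card U)"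
proof -
  \<comment> \<open>Against eigenfunctions for \<open>x\<close>, a test function \<open>u\<close>
    acts only through its component \<open>W u x\<close>, so Gram-Schmidt can run inside the
    eigenspace.\<close>
  have "\<forall>u\<in>U. \<exists>F. (\<forall>y\<in>spec n. eigen n y (F y)) \<and> (\<forall>s. u s = (\<Sum>y\<in>spec n. F y s))"
    using eigen_decomposition[OF U(2)] by blast
  then obtain W where W: "\<And>u y. u \<in> U \<Longrightarrow> y \<in> spec n \<Longrightarrow> eigen n y (W u y)"
    "\<And>u s. u \<in> U \<Longrightarrow> u s = (\<Sum>y\<in>spec n. W u y s)" by metis
  have ipW: "ip n f u = ip n f (W u x)" if "u \<in> U" "eigen n x f" for u f
    using W that by (intro ip_component x) auto
  obtain k :: nat and v where k: "k \<le> card U" and v: "\<And>i. i < k \<Longrightarrow> eigen n x (v i)"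
    and on: "\<And>i j. i < k \<Longrightarrow> j < k \<Longrightarrow> ip n (v i) (v j) = (if i = j then 1 else 0)"
    and perp: "\<And>f u. (\<forall>i<k. ip n f (v i) = 0) \<Longrightarrow> u \<in> U \<Longrightarrow> ip n f (W u x) = 0"
    using gram_schmidt[OF U(1), of n x "\<lambda>u. W u x"] W(1) x by metis
  \<comment> \<open>The residual of \<open>f\<close> is orthogonal to all of \<open>U\<close>, so
    \<open>sep\<close> makes it zero: the \<open>v i\<close> form an orthonormal basis of the
    eigenspace.\<close>
  have expand: "f s = (\<Sum>i<k. ip n f (v i) * v i s)" if f: "eigen n x f" for f s
  proof -
    define h where "h = (\<lambda>s. f s - (\<Sum>i<k. ip n f (v i) * v i s))"
    have h: "eigen n x h"
      unfolding h_def by (intro eigen_diff eigen_sum eigen_cmult f v) auto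
    have "ip n h (v j) = 0" if j: "j < k" for j
    proof -
      have "(\<Sum>i<k. ip n f (v i) * ip n (v i) (v j)) = (\<Sum>i<k. if i = j then ip n f (v i) else 0)"
        by (intro sum.cong refl) (use on j in auto)
      then show ?thesis unfolding h_def using j by (simp add: ip_diff_left ip_sum_left ip_cmult_left)
    qed
    then have "\<forall>u\<in>U. ip n h u = 0" using perp[of h] ipW[OF _ h] by simp
    then have "h s = 0" using sep[OF h] by blast
    then show ?thesis by (simp add: h_def)
  qed
  \<comment> \<open>Left translation carries the point mass at the identity to the one at
    \<open>s\<close>, so the diagonal of the projection kernel is constant; its sum over the group
    is \<open>k\<close>.\<close>
  have diag: "point_component n x id = (\<Sum>i<k. v i s * v i s)" if s: "s \<in> perms n" for s
  proof -
    define F where "F = (\<lambda>y t. point_component n y (inv s \<circ> t))"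
    have F: "eigen n y (F y)" if y: "y \<in> spec n" for y
    proof -
      have "walk n (F y) t = walk n (point_component n y) (inv s \<circ> t)" for t
        by (simp add: walk_def F_def comp_assoc)
      then show ?thesis using point_component(1)[OF y] s
        by (simp add: eigen_def supported_def F_def)
    qed
    have "point s t = (\<Sum>y\<in>spec n. F y t)" for t
    proof -
      have "inv s \<circ> t = id \<longleftrightarrow> t = s"
        using perms_inv_o[OF s] perms_cancel(1)[OF s, of t] by (metis comp_id)
      then have "point s t = point id (inv s \<circ> t)" by (simp add: point_def)
      then show ?thesis by (simp add: point_component(2) F_def)
    qed
    then have "ip n (v i) (point s) = ip n (v i) (F x)" if "i < k" for i
      by (intro ip_component F x v that)
    then have "ip n (F x) (v i) = v i s" if "i < k" for i
      using that s ip_point[of s n "v i"] by (simp add: ip_commute)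
    then have "F x s = (\<Sum>i<k. v i s * v i s)"
      using expand[OF F[OF x], of s] by simp
    then show ?thesis using s by (simp add: F_def)
  qed
  have "fact n * point_component n x id = (\<Sum>s\<in>perms n. point_component n x id)"
    by (simp add: card_perms)
  also have "\<dots> = (\<Sum>s\<in>perms n. \<Sum>i<k. v i s * v i s)"
    by (intro sum.cong refl diag)
  also have "\<dots> = (\<Sum>i<k. ip n (v i) (v i))"
    unfolding ip_def by (rule sum.swap)
  also have "\<dots> = real k" using on by simp
  finally show ?thesis using k by simp
qed

section \<open>Bounds for Hurwitz numbers\<close>

definition mass :: "nat \<Rightarrow> (nat \<Rightarrow> nat) \<Rightarrow> nat" where
  "mass n \<psi> = card {a \<in> {1..n}. \<psi> a \<noteq> 0}"

text \<open>Colour \<open>0\<close> marks the points that must be fixed individually.\<close>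

definition pointed_stab :: "nat \<Rightarrow> (nat \<Rightarrow> nat) \<Rightarrow> (nat \<Rightarrow> nat) set" where
  "pointed_stab n \<psi> = {p \<in> stab n \<psi>. \<forall>a\<in>{1..n}. \<psi> a = 0 \<longrightarrow> p a = a}"

text \<open>The indicator of the left coset of \<open>s\<close>; the inner product with it sums a
  function over this coset.\<close>

definition coset_indicator :: "nat \<Rightarrow> (nat \<Rightarrow> nat) \<Rightarrow> (nat \<Rightarrow> nat) \<Rightarrow> (nat \<Rightarrow> nat) \<Rightarrow> real" where
  "coset_indicator n \<psi> s t = (if inv s \<circ> t \<in> pointed_stab n \<psi> then 1 else 0)"

text \<open>\<open>k ^ k / fact k\<close> is a single term of the series of
  \<open>exp k\<close>.\<close>

lemma power_div_exp_le_fact: "(real k / exp 1) ^ k \<le> fact k"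
proof -
  have s: "summable (\<lambda>i. real k ^ i /\<^sub>R fact i)" by (rule summable_exp_generic)
  have "(\<Sum>i\<in>{k}. real k ^ i /\<^sub>R fact i) \<le> (\<Sum>i. real k ^ i /\<^sub>R fact i)"
    by (rule sum_le_suminf[OF s]) auto
  then have "real k ^ k / fact k \<le> exp (real k)"
    by (simp add: exp_def divide_inverse mult.commute)
  then have "real k ^ k \<le> exp 1 ^ k * fact k"
    by (simp add: field_simps exp_of_nat_mult[symmetric])
  then show ?thesis by (simp add: power_divide field_simps)
qed

section \<open>Sizes and cosets of the Young subgroups\<close>

lemma pointed_stab_comp:
  assumes "p \<in> pointed_stab n \<psi>" "q \<in> pointed_stab n \<psi>" shows "p \<circ> q \<in> pointed_stab n \<psi>"
  using assms stab_comp by (auto simp: pointed_stab_def)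

lemma pointed_stab_perms: "p \<in> pointed_stab n \<psi> \<Longrightarrow> p \<in> perms n"
  by (auto simp: pointed_stab_def stab_perms)

lemma pointed_stab_inv:
  assumes "p \<in> pointed_stab n \<psi>" shows "inv p \<in> pointed_stab n \<psi>"
proof -
  have "inv p a = a" if "a \<in> {1..n}" "\<psi> a = 0" for a
  proof -
    have "p a = a" using assms that by (simp add: pointed_stab_def)
    then show ?thesis using perms_inv_apply(2)[OF pointed_stab_perms[OF assms], of a] by simp
  qed
  then show ?thesis using assms by (simp add: pointed_stab_def stab_inv)
qed

lemma finite_pointed_stab [simp]: "finite (pointed_stab n \<psi>)"
  by (rule finite_subset[OF _ finite_stab]) (auto simp: pointed_stab_def)

lemma id_pointed_stab: "id \<in> pointed_stab n \<psi>"
  by (auto simp: pointed_stab_def stab_def)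

text \<open>The group contains the product of the symmetric groups on the nonzero classes. A class
  of size \<open>v \<ge> T\<close> contributes \<open>fact v\<close>, at least
  \<open>(v / e) ^ v\<close> and so at least \<open>(T / e) ^ v\<close>. The product is built colour
  by colour.\<close>

lemma card_pointed_stab_ge:
  fixes T :: real
  assumes T: "T > 0" and cls: "\<And>c. c \<noteq> 0 \<Longrightarrow> {a \<in> {1..n}. \<psi> a = c} = {} \<or> T \<le> real (card {a \<in> {1..n}. \<psi> a = c})"
  shows "(T / exp 1) ^ mass n \<psi> \<le> real (card (pointed_stab n \<psi>))"
proof -
  define D where "D k = {a \<in> {1..n}. \<psi> a \<in> {1..k}}" for k
  define Q where "Q k = {p. p permutes D k \<and> (\<forall>a\<in>{1..n}. \<psi> (p a) = \<psi> a)}" for k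
  have finD: "finite (D k)" for k by (auto simp: D_def)
  have finQ: "finite (Q k)" for k
    by (rule finite_subset[OF _ finite_permutations[OF finD[of k]]]) (auto simp: Q_def)
  have main: "(T / exp 1) ^ card (D k) \<le> real (card (Q k))" for k
  proof (induction k)
    case 0
    have "D 0 = {}" by (auto simp: D_def)
    moreover have "Q 0 = {id}" unfolding Q_def \<open>D 0 = {}\<close> by auto
    ultimately show ?case by simp
  next
    case (Suc k)
    define V where "V = {a \<in> {1..n}. \<psi> a = Suc k}"
    have finV: "finite V" by (auto simp: V_def)
    have DS: "D (Suc k) = D k \<union> V" and dis: "D k \<inter> V = {}"
      by (auto simp: D_def V_def)
    define P where "P = {q. q permutes V}"
    have finP: "finite P" unfolding P_def by (rule finite_permutations[OF finV])
    have fixV: "p a = a" if "p \<in> Q k" "a \<in> V" for p a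
      using that dis permutes_not_in[of p "D k" a] by (auto simp: Q_def)
    \<comment> \<open>\<open>p\<close> fixes \<open>V\<close> pointwise, while \<open>q\<close>
      preserves \<open>V\<close> and fixes everything else, so \<open>p \<circ> q\<close> determines
      both.\<close>
    have inj: "inj_on (\<lambda>(p, q). p \<circ> q) (Q k \<times> P)"
    proof (rule inj_onI, clarify)
      fix p q p' q' assume h: "p \<in> Q k" "q \<in> P" "p' \<in> Q k" "q' \<in> P" "p \<circ> q = p' \<circ> q'"
      have "q a = q' a" for a
      proof (cases "a \<in> V")
        case True
        then have "q a \<in> V" "q' a \<in> V" using h permutes_in_image[of _ V a] by (auto simp: P_def)
        then show ?thesis using fixV[OF h(1)] fixV[OF h(3)] fun_cong[OF h(5), of a]
          by (metis comp_apply)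
      next
        case False
        then show ?thesis using h by (simp add: P_def permutes_not_in)
      qed
      then have qq: "q = q'" by blast
      have "bij q" using h(2) permutes_bij by (auto simp: P_def)
      then have "surj q" by (rule bij_is_surj)
      have "p a = p' a" for a
      proof -
        obtain b where "a = q b" using \<open>surj q\<close> by blast
        then show ?thesis using fun_cong[OF h(5), of b] qq by simp
      qed
      then have "p = p'" by blast
      then show "p = p' \<and> q = q'" using qq by blast
    qed
    have "(\<lambda>(p, q). p \<circ> q) ` (Q k \<times> P) \<subseteq> Q (Suc k)"
    proof clarify
      fix p q assume p: "p \<in> Q k" and q: "q \<in> P"
      have 1: "p permutes D (Suc k)" "q permutes D (Suc k)"
        using p q DS by (auto simp: Q_def P_def intro: permutes_subset)
      have "\<psi> (p (q a)) = \<psi> a" if a: "a \<in> {1..n}" for a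
      proof (cases "a \<in> V")
        case True
        then have "q a \<in> V" using q permutes_in_image[of q V a] by (auto simp: P_def)
        then show ?thesis using fixV[OF p] True by (auto simp: V_def)
      next
        case False
        then have "q a = a" using q by (simp add: P_def permutes_not_in)
        then show ?thesis using p a by (simp add: Q_def)
      qed
      then show "p \<circ> q \<in> Q (Suc k)" using permutes_compose[OF 1(2) 1(1)] by (simp add: Q_def)
    qed
    then have "card (Q k \<times> P) \<le> card (Q (Suc k))"
      using card_inj_on_le[OF inj _ finQ] by blast
    then have "card (Q k) * fact (card V) \<le> card (Q (Suc k))"
      unfolding card_cartesian_product P_def card_permutations[OF refl finV] .
    then have le: "real (card (Q k)) * fact (card V) \<le> real (card (Q (Suc k)))"
      by (metis of_nat_fact of_nat_mono of_nat_mult)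
    have "(T / exp 1) ^ card V \<le> fact (card V)"
    proof (cases "V = {}")
      case False
      then have "T \<le> real (card V)" using cls[of "Suc k"] by (auto simp: V_def)
      then have "(T / exp 1) ^ card V \<le> (real (card V) / exp 1) ^ card V"
        using T by (intro power_mono divide_right_mono) auto
      also have "\<dots> \<le> fact (card V)" by (rule power_div_exp_le_fact)
      finally show ?thesis .
    qed simp
    then have "(T / exp 1) ^ card (D k) * (T / exp 1) ^ card V \<le> real (card (Q k)) * fact (card V)"
      using Suc.IH T by (intro mult_mono) auto
    also note le
    finally show ?case unfolding DS using card_Un_disjoint[OF finD finV dis]
      by (simp add: power_add)
  qed
  define k where "k = (\<Sum>a\<in>{1..n}. \<psi> a)"
  have Dk: "D k = {a \<in> {1..n}. \<psi> a \<noteq> 0}"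
  proof -
    have "\<psi> a \<le> k" if "a \<in> {1..n}" for a unfolding k_def by (rule member_le_sum) (use that in auto)
    then show ?thesis by (auto simp: D_def)
  qed
  have "Q k \<subseteq> pointed_stab n \<psi>"
  proof
    fix p assume p: "p \<in> Q k"
    then have "p permutes {1..n}" by (auto simp: Q_def Dk intro: permutes_subset)
    moreover have "p a = a" if "\<psi> a = 0" for a
      using p that by (auto simp: Q_def Dk intro: permutes_not_in)
    ultimately show "p \<in> pointed_stab n \<psi>" using p
      by (auto simp: pointed_stab_def stab_def perms_def Q_def)
  qed
  then have "card (Q k) \<le> card (pointed_stab n \<psi>)" by (intro card_mono) auto
  then show ?thesis using main[of k] unfolding Dk mass_def by linarith
qed

lemma card_image_fibres:
  assumes "finite A" "\<And>x. x \<in> A \<Longrightarrow> k \<le> card {y \<in> A. f y = f x}"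
  shows "card (f ` A) * k \<le> card A"
proof -
  have "card (f ` A) * k = (\<Sum>z\<in>f ` A. k)" by simp
  also have "\<dots> \<le> (\<Sum>z\<in>f ` A. card {y \<in> A. f y = z})"
    by (intro sum_mono) (use assms in auto)
  also have "\<dots> = card A"
    using sum.image_gen[OF assms(1), of "\<lambda>_. 1::nat" f] by simp
  finally show ?thesis .
qed

text \<open>Right multiplication of \<open>s\<close> by the subgroup leaves its indicator unchanged,
  so each fibre is at least as large as the subgroup.\<close>

lemma card_coset_indicators:
  "card (coset_indicator n \<psi> ` perms n) * card (pointed_stab n \<psi>) \<le> fact n"
proof -
  have "card (coset_indicator n \<psi> ` perms n) * card (pointed_stab n \<psi>) \<le> card (perms n)"
  proof (rule card_image_fibres)
    fix s assume s: "s \<in> perms n"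
    have "coset_indicator n \<psi> (s \<circ> p) = coset_indicator n \<psi> s" if p: "p \<in> pointed_stab n \<psi>" for p
    proof
      fix t :: "nat \<Rightarrow> nat"
      have P: "p \<in> perms n" using p by (rule pointed_stab_perms)
      have "inv (s \<circ> p) = inv p \<circ> inv s"
        using s P by (intro o_inv_distrib) (auto simp: perms_def permutes_bij)
      then have eq: "inv (s \<circ> p) \<circ> t = inv p \<circ> (inv s \<circ> t)" by (simp add: comp_assoc)
      have "inv s \<circ> t = p \<circ> (inv (s \<circ> p) \<circ> t)" unfolding eq by (rule perms_cancel(1)[OF P, symmetric])
      then have "inv (s \<circ> p) \<circ> t \<in> pointed_stab n \<psi> \<longleftrightarrow> inv s \<circ> t \<in> pointed_stab n \<psi>"
        using pointed_stab_comp[OF p] pointed_stab_comp[OF pointed_stab_inv[OF p]] eq by metis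
      then show "coset_indicator n \<psi> (s \<circ> p) t = coset_indicator n \<psi> s t"
        by (simp add: coset_indicator_def)
    qed
    then have "(\<lambda>p. s \<circ> p) ` pointed_stab n \<psi> \<subseteq> {y \<in> perms n. coset_indicator n \<psi> y = coset_indicator n \<psi> s}"
      using s pointed_stab_perms by auto
    then have "card ((\<lambda>p. s \<circ> p) ` pointed_stab n \<psi>) \<le> card {y \<in> perms n. coset_indicator n \<psi> y = coset_indicator n \<psi> s}"
      by (intro card_mono) auto
    moreover have "inj_on (\<lambda>p. s \<circ> p) (pointed_stab n \<psi>)"
      by (rule inj_on_inverseI[where g = "\<lambda>p. inv s \<circ> p"]) (simp add: perms_cancel[OF s])
    ultimately show "card (pointed_stab n \<psi>) \<le> card {y \<in> perms n. coset_indicator n \<psi> y = coset_indicator n \<psi> s}"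
      by (simp add: card_image)
  qed simp
  then show ?thesis by (simp add: card_perms)
qed

lemma supported_coset_indicator:
  assumes "s \<in> perms n" shows "supported n (coset_indicator n \<psi> s)"
  using pointed_stab_perms comp_perms_left_iff[OF inv_perms[OF assms]]
  unfolding supported_def coset_indicator_def by metis

lemma ip_coset_indicator:
  assumes s: "s \<in> perms n"
  shows "ip n f (coset_indicator n \<psi> s) = (\<Sum>p\<in>pointed_stab n \<psi>. f (s \<circ> p))"
proof -
  have "ip n f (coset_indicator n \<psi> s) = (\<Sum>t\<in>perms n. if inv s \<circ> t \<in> pointed_stab n \<psi> then f t else 0)"
    unfolding ip_def coset_indicator_def by (intro sum.cong) auto
  also have "\<dots> = (\<Sum>p\<in>perms n. if p \<in> pointed_stab n \<psi> then f (s \<circ> p) else 0)"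
    by (subst sum.reindex_bij_betw[OF bij_betw_perms_left[OF s], symmetric])
       (simp add: perms_cancel[OF s])
  also have "\<dots> = (\<Sum>p\<in>perms n \<inter> pointed_stab n \<psi>. f (s \<circ> p))"
    by (subst sum.inter_restrict) auto
  also have "perms n \<inter> pointed_stab n \<psi> = pointed_stab n \<psi>" using pointed_stab_perms by auto
  finally show ?thesis .
qed

text \<open>Only the colour classes with at least \<open>T\<close> elements are kept; the others contribute at
  most \<open>n * T / 2\<close> to the eigenvalue.\<close>

lemma eigenfunction_detected:
  fixes T :: real
  assumes f: "eigen n x f" "f s0 \<noteq> 0" and T: "T > 0"
  shows "\<exists>\<psi>\<in>{1..n} \<rightarrow>\<^sub>E {..nat \<lfloor>n / T\<rfloor>}. x \<le> (real (mass n \<psi>) + sqrt (n * T)) ^ 2 / 2 \<and>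
    (T / exp 1) ^ mass n \<psi> \<le> real (card (pointed_stab n \<psi>)) \<and>
    (\<exists>s\<in>perms n. ip n f (coset_indicator n \<psi> s) \<noteq> 0)"
proof -
  obtain \<phi> s where \<phi>: "\<phi> \<in> colourings n" "content n \<phi> = x" "symmetrise n \<phi> f s \<noteq> 0"
    using eigenvalue_content[OF f] by blast
  define cl where "cl c = {a \<in> {1..n}. \<phi> a = c}" for c
  have fincl: "finite (cl c)" for c by (simp add: cl_def)
  define B where "B = {c \<in> {..<n}. T \<le> real (card (cl c))}"
  have finB: "finite B" by (simp add: B_def)
  \<comment> \<open>The large classes are disjoint, so there are at most \<open>n / T\<close> of
    them.\<close>
  have "real (card B) * T = (\<Sum>c\<in>B. T)" by simp
  also have "\<dots> \<le> (\<Sum>c\<in>B. real (card (cl c)))" by (intro sum_mono) (auto simp: B_def)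
  also have "\<dots> = real (card (\<Union>c\<in>B. cl c))"
    by (subst card_UN_disjoint) (use finB fincl in \<open>auto simp: cl_def\<close>)
  also have "\<dots> \<le> real (card {1..n})" by (intro of_nat_mono card_mono) (auto simp: cl_def)
  finally have "real (card B) \<le> n / T" using T by (simp add: field_simps)
  then have cB: "card B \<le> nat \<lfloor>n / T\<rfloor>" by (simp add: le_nat_floor)
  obtain h where h: "bij_betw h B {0..<card B}" using ex_bij_betw_finite_nat[OF finB] by blast
  \<comment> \<open>Large classes are renumbered from \<open>1\<close>; colour \<open>0\<close>
    collects all small classes.\<close>
  define \<psi> where "\<psi> = (\<lambda>a\<in>{1..n}. if \<phi> a \<in> B then Suc (h (\<phi> a)) else 0)"
  have "\<psi> a \<le> nat \<lfloor>n / T\<rfloor>" if "a \<in> {1..n}" for a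
    using that bij_betwE[OF h] cB by (fastforce simp: \<psi>_def)
  then have \<psi>E: "\<psi> \<in> {1..n} \<rightarrow>\<^sub>E {..nat \<lfloor>n / T\<rfloor>}" by (auto simp: \<psi>_def)
  have \<psi>0: "\<psi> a \<noteq> 0 \<longleftrightarrow> \<phi> a \<in> B" if "a \<in> {1..n}" for a using that by (auto simp: \<psi>_def)
  have \<psi>eq: "\<phi> a = \<phi> b" if "a \<in> {1..n}" "b \<in> {1..n}" "\<psi> a = \<psi> b" "\<psi> b \<noteq> 0" for a b
    using that bij_betw_imp_inj_on[OF h] by (auto simp: \<psi>_def inj_on_def split: if_splits)
  have sub: "pointed_stab n \<psi> \<subseteq> stab n \<phi>"
  proof
    fix p assume p: "p \<in> pointed_stab n \<psi>"
    then have P: "p \<in> perms n" by (rule pointed_stab_perms)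
    have "\<phi> (p a) = \<phi> a" if a: "a \<in> {1..n}" for a
    proof (cases "\<psi> a = 0")
      case True
      then show ?thesis using p a by (simp add: pointed_stab_def)
    next
      case False
      moreover have "p a \<in> {1..n}" using a perms_in_iff[OF P] by blast
      moreover have "\<psi> (p a) = \<psi> a" using p a unfolding pointed_stab_def stab_def by blast
      ultimately show ?thesis using \<psi>eq a by blast
    qed
    then show "p \<in> stab n \<phi>" using P by (simp add: stab_def)
  qed
  have "(T / exp 1) ^ mass n \<psi> \<le> real (card (pointed_stab n \<psi>))"
  proof (rule card_pointed_stab_ge[OF T])
    fix c :: nat assume c: "c \<noteq> 0"
    show "{a \<in> {1..n}. \<psi> a = c} = {} \<or> T \<le> real (card {a \<in> {1..n}. \<psi> a = c})"
    proof (cases "{a \<in> {1..n}. \<psi> a = c} = {}")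
      case False
      then obtain b where b: "b \<in> {1..n}" "\<psi> b = c" by auto
      then have "\<phi> b \<in> B" using \<psi>0[of b] c by simp
      moreover have "{a \<in> {1..n}. \<psi> a = c} = cl (\<phi> b)"
      proof (intro equalityI subsetI)
        fix a assume "a \<in> {a \<in> {1..n}. \<psi> a = c}"
        then show "a \<in> cl (\<phi> b)" using b c \<psi>eq[of a b] by (simp add: cl_def)
      next
        fix a assume "a \<in> cl (\<phi> b)"
        then have "a \<in> {1..n}" "\<phi> a = \<phi> b" by (simp_all add: cl_def)
        then show "a \<in> {a \<in> {1..n}. \<psi> a = c}" using b by (simp add: \<psi>_def split: if_splits)
      qed
      ultimately show ?thesis by (simp add: B_def)
    qed simp
  qed
  moreover have "x \<le> (real (mass n \<psi>) + sqrt (n * T)) ^ 2 / 2"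
  proof -
    let ?M = "real (mass n \<psi>)"
    have half: "2 * (u / 2 - v) \<le> w" if "u \<le> w" "0 \<le> v" for u v w :: real
      using that by simp
    \<comment> \<open>A point of a large class has partners only among the covered points, any other
      point fewer than \<open>T\<close>. Later \<open>half\<close> discards the nonnegative colour
      sum.\<close>
    have "real (card {a \<in> {1..n} - {b}. \<phi> a = \<phi> b}) \<le> (if \<psi> b \<noteq> 0 then ?M else 0) + T"
      if b: "b \<in> {1..n}" for b
    proof (cases "\<psi> b = 0")
      case True
      have "\<phi> b \<in> {..<n}" using \<phi>(1) b by (auto simp: colourings_def)
      then have "real (card (cl (\<phi> b))) < T" using True \<psi>0[OF b] by (auto simp: B_def)
      moreover have "card {a \<in> {1..n} - {b}. \<phi> a = \<phi> b} \<le> card (cl (\<phi> b))"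
        by (intro card_mono fincl) (auto simp: cl_def)
      ultimately show ?thesis using True by simp
    next
      case False
      have "card {a \<in> {1..n} - {b}. \<phi> a = \<phi> b} \<le> mass n \<psi>"
        unfolding mass_def by (intro card_mono) (use \<psi>0 False b in auto)
      then show ?thesis using False T by simp
    qed
    then have "(\<Sum>b\<in>{1..n}. real (card {a \<in> {1..n} - {b}. \<phi> a = \<phi> b}))
        \<le> (\<Sum>b\<in>{1..n}. (if \<psi> b \<noteq> 0 then ?M else 0) + T)" by (rule sum_mono)
    also have "\<dots> = ?M * ?M + n * T"
      unfolding sum.distrib by (subst sum.inter_filter[symmetric]) (auto simp: mass_def)
    finally have "2 * x \<le> ?M * ?M + n * T"
      using half[OF _ of_nat_0_le_iff[of "\<Sum>b\<in>{1..n}. \<phi> b"]]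
      unfolding \<phi>(2)[symmetric] content_def of_nat_sum by blast
    also have "\<dots> \<le> (?M + sqrt (n * T)) ^ 2"
      using T by (simp add: power2_eq_square algebra_simps)
    finally show ?thesis by simp
  qed
  \<comment> \<open>\<open>stab n \<phi>\<close> is a union of left cosets of
    \<open>pointed_stab n \<psi>\<close>: if all coset sums of \<open>f\<close> vanished, so would
    its symmetrisation.\<close>
  moreover have "\<exists>s\<in>perms n. ip n f (coset_indicator n \<psi> s) \<noteq> 0"
  proof (rule ccontr)
    assume "\<not> ?thesis"
    then have z: "(\<Sum>p\<in>pointed_stab n \<psi>. f (s \<circ> p)) = 0" if "s \<in> perms n" for s
      using that ip_coset_indicator by metis
    have s: "s \<in> perms n"
    proof (rule ccontr)
      assume "s \<notin> perms n"
      then have "s \<circ> p \<notin> perms n" if "p \<in> stab n \<phi>" for p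
        using comp_perms_right_iff[OF stab_perms[OF that]] by blast
      then have "symmetrise n \<phi> f s = 0"
        using f(1) unfolding symmetrise_def eigen_def supported_def by (intro sum.neutral) blast
      then show False using \<phi>(3) by simp
    qed
    have tr: "(\<Sum>q\<in>stab n \<phi>. f (s \<circ> q \<circ> p)) = symmetrise n \<phi> f s" if p: "p \<in> pointed_stab n \<psi>" for p
    proof -
      have p: "p \<in> stab n \<phi>" using p sub by blast
      have P: "p \<in> perms n" using p by (rule stab_perms)
      have "bij_betw (\<lambda>q. q \<circ> p) (stab n \<phi>) (stab n \<phi>)"
        by (rule bij_betwI[where g = "\<lambda>q. q \<circ> inv p"])
           (use p in \<open>auto intro: stab_comp stab_inv simp: perms_cancel[OF P]\<close>)
      then show ?thesis unfolding symmetrise_def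
        using sum.reindex_bij_betw[of "\<lambda>q. q \<circ> p" "stab n \<phi>" "stab n \<phi>" "\<lambda>q. f (s \<circ> q)"]
        by (simp add: comp_assoc)
    qed
    have "real (card (pointed_stab n \<psi>)) * symmetrise n \<phi> f s
        = (\<Sum>p\<in>pointed_stab n \<psi>. \<Sum>q\<in>stab n \<phi>. f (s \<circ> q \<circ> p))"
      by (simp add: tr)
    also have "\<dots> = (\<Sum>q\<in>stab n \<phi>. \<Sum>p\<in>pointed_stab n \<psi>. f (s \<circ> q \<circ> p))"
      by (rule sum.swap)
    also have "\<dots> = 0"
      by (intro sum.neutral ballI z comp_perms s stab_perms)
    finally show False using \<phi>(3) id_pointed_stab[of n \<psi>] finite_pointed_stab[of n \<psi>]
      by (auto simp: card_eq_0_iff)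
  qed
  ultimately show ?thesis using \<psi>E by blast
qed

section \<open>Multiplicities and the upper bound\<close>

lemma eigen_sign:
  assumes "eigen n x f" shows "eigen n (- x) (\<lambda>s. real_of_int (sign s) * f s)"
  unfolding eigen_def
proof (intro conjI allI)
  have f: "supported n f" "\<And>s. walk n f s = x * f s" using assms by (auto simp: eigen_def)
  show "supported n (\<lambda>s. real_of_int (sign s) * f s)" using f by (simp add: supported_def)
  fix s
  \<comment> \<open>Transpositions are odd, so the sign flips; outside \<open>perms n\<close> both
    sides vanish.\<close>
  have "real_of_int (sign (s \<circ> t)) * f (s \<circ> t) = - real_of_int (sign s) * f (s \<circ> t)"
    if t: "t \<in> transpositions n" for t
  proof (cases "s \<in> perms n")
    case True
    then have "permutation s" "permutation t"
      using transpositions_perms[OF t] by (auto simp: perms_def intro: permutes_imp_permutation)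
    moreover have "sign t = - 1" using t by (auto simp: transpositions_def sign_swap_id)
    ultimately show ?thesis by (simp add: sign_compose)
  next
    case False
    then have "f (s \<circ> t) = 0"
      using f(1) comp_perms_right_iff[OF transpositions_perms[OF t]] unfolding supported_def by blast
    then show ?thesis by simp
  qed
  then have "walk n (\<lambda>s. real_of_int (sign s) * f s) s = (\<Sum>t\<in>transpositions n. - real_of_int (sign s) * f (s \<circ> t))"
    unfolding walk_def by (intro sum.cong) auto
  also have "\<dots> = - real_of_int (sign s) * walk n f s"
    by (simp add: walk_def sum_distrib_left sum_negf)
  finally show "walk n (\<lambda>s. real_of_int (sign s) * f s) s = - x * (real_of_int (sign s) * f s)"
    by (simp add: f(2))
qed

text \<open>The eigenspace is separated by the coset indicators of all subgroups that
  \<open>eigenfunction_detected\<close> can yield, each with at most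
  \<open>fact n * (exp 1 / T) ^ mass n \<psi>\<close> indicators. The factor \<open>fact n\<close>
  cancels.\<close>

lemma point_component_le:
  fixes T :: real
  assumes y: "y \<in> spec n" and T: "T > 0"
  shows "point_component n y id
    \<le> (\<Sum>\<psi>\<in>{\<psi> \<in> {1..n} \<rightarrow>\<^sub>E {..nat \<lfloor>n / T\<rfloor>}. \<bar>y\<bar> \<le> (real (mass n \<psi>) + sqrt (n * T)) ^ 2 / 2}. (exp 1 / T) ^ mass n \<psi>)"
proof -
  let ?big = "\<lambda>\<psi>. (T / exp 1) ^ mass n \<psi> \<le> real (card (pointed_stab n \<psi>))"
  define \<Psi> where "\<Psi> = {\<psi> \<in> {1..n} \<rightarrow>\<^sub>E {..nat \<lfloor>n / T\<rfloor>}. \<bar>y\<bar> \<le> (real (mass n \<psi>) + sqrt (n * T)) ^ 2 / 2}"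
  have fin: "finite \<Psi>"
    unfolding \<Psi>_def by (rule finite_subset[of _ "{1..n} \<rightarrow>\<^sub>E {..nat \<lfloor>n / T\<rfloor>}"]) (auto intro: finite_PiE)
  define U where "U = (\<Union>\<psi>\<in>{\<psi> \<in> \<Psi>. ?big \<psi>}. coset_indicator n \<psi> ` perms n)"
  have finU: "finite U" unfolding U_def using fin by auto
  have cardU: "real (card U) \<le> fact n * (\<Sum>\<psi>\<in>\<Psi>. (exp 1 / T) ^ mass n \<psi>)"
  proof -
    have "card U \<le> (\<Sum>\<psi>\<in>{\<psi> \<in> \<Psi>. ?big \<psi>}. card (coset_indicator n \<psi> ` perms n))"
      unfolding U_def by (rule card_UN_le) (use fin in auto)
    then have "real (card U) \<le> (\<Sum>\<psi>\<in>{\<psi> \<in> \<Psi>. ?big \<psi>}. real (card (coset_indicator n \<psi> ` perms n)))"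
      unfolding of_nat_sum[symmetric] of_nat_le_iff .
    also have "\<dots> \<le> (\<Sum>\<psi>\<in>{\<psi> \<in> \<Psi>. ?big \<psi>}. fact n * (exp 1 / T) ^ mass n \<psi>)"
    proof (rule sum_mono)
      fix \<psi> assume "\<psi> \<in> {\<psi> \<in> \<Psi>. ?big \<psi>}"
      then have b: "?big \<psi>" by simp
      have "real (card (coset_indicator n \<psi> ` perms n)) * (T / exp 1) ^ mass n \<psi>
          \<le> real (card (coset_indicator n \<psi> ` perms n)) * real (card (pointed_stab n \<psi>))"
        by (rule mult_left_mono[OF b]) simp
      also have "\<dots> \<le> fact n"
        using of_nat_mono[OF card_coset_indicators[of n \<psi>], where 'a = real] unfolding of_nat_mult of_nat_fact .
      finally show "real (card (coset_indicator n \<psi> ` perms n)) \<le> fact n * (exp 1 / T) ^ mass n \<psi>"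
        using T by (simp add: power_divide field_simps)
    qed
    also have "\<dots> \<le> (\<Sum>\<psi>\<in>\<Psi>. fact n * (exp 1 / T) ^ mass n \<psi>)"
      by (rule sum_mono2) (use fin T in auto)
    finally show ?thesis by (simp add: sum_distrib_left)
  qed
  have Usup: "supported n u" if "u \<in> U" for u
    using that supported_coset_indicator by (auto simp: U_def)
  have sep: "\<forall>s. f s = 0" if f: "eigen n \<bar>y\<bar> f" and perp: "\<forall>u\<in>U. ip n f u = 0" for f
  proof (rule ccontr)
    assume "\<not> (\<forall>s. f s = 0)"
    then obtain s0 where "f s0 \<noteq> 0" by blast
    from eigenfunction_detected[OF f this T] show False
      using perp unfolding U_def \<Psi>_def by blast
  qed
  have "fact n * point_component n y id \<le> real (card U)"
  proof (cases "y \<ge> 0")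
    case True
    then show ?thesis
      by (intro fact_point_component_le y finU Usup) (use sep in auto)
  next
    case False
    \<comment> \<open>For negative \<open>y\<close> the sign twist is moved from the eigenfunction
      to the test functions.\<close>
    define U' where "U' = (\<lambda>u s. real_of_int (sign s) * u s) ` U"
    have "fact n * point_component n y id \<le> real (card U')"
    proof (rule fact_point_component_le[OF y])
      show "finite U'" using finU by (simp add: U'_def)
      show "supported n u" if "u \<in> U'" for u using that Usup by (auto simp: U'_def supported_def)
      fix f assume f: "eigen n y f" and perp: "\<forall>u\<in>U'. ip n f u = 0"
      have "eigen n \<bar>y\<bar> (\<lambda>s. real_of_int (sign s) * f s)" using eigen_sign[OF f] False by simp
      moreover have "ip n (\<lambda>s. real_of_int (sign s) * f s) u = 0" if "u \<in> U" for u
      proof -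
        have "ip n (\<lambda>s. real_of_int (sign s) * f s) u = ip n f (\<lambda>s. real_of_int (sign s) * u s)"
          by (simp add: ip_def algebra_simps)
        then show ?thesis using perp that by (simp add: U'_def)
      qed
      ultimately have "\<forall>s. real_of_int (sign s) * f s = 0" using sep by blast
      then show "\<forall>s. f s = 0" by simp
    qed
    also have "card U' \<le> card U" unfolding U'_def by (rule card_image_le[OF finU])
    finally show ?thesis by simp
  qed
  also note cardU
  finally show ?thesis unfolding \<Psi>_def[symmetric] by simp
qed

text \<open>Twice a content is an integer between \<open>- 2 * n ^ 2\<close> and
  \<open>n ^ 2\<close>; hence the number of eigenvalues costs only a polynomial factor.\<close>

lemma card_spec_le: "card (spec n) \<le> 3 * n ^ 2 + 1"
proof -
  have "spec n \<subseteq> (\<lambda>k. real_of_int k / 2) ` {- 2 * int (n ^ 2)..int (n ^ 2)}"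
  proof
    fix x assume "x \<in> spec n"
    then obtain \<phi> where \<phi>: "\<phi> \<in> colourings n" "x = content n \<phi>" by (auto simp: spec_def)
    define K where "K = (\<Sum>b\<in>{1..n}. card {a \<in> {1..n} - {b}. \<phi> a = \<phi> b})"
    define S where "S = (\<Sum>b\<in>{1..n}. \<phi> b)"
    have "card {a \<in> {1..n} - {b}. \<phi> a = \<phi> b} \<le> card {1..n}" for b by (rule card_mono) auto
    then have K: "K \<le> n ^ 2" unfolding K_def power2_eq_square
      using sum_bounded_above[of "{1..n}" "\<lambda>b. card {a \<in> {1..n} - {b}. \<phi> a = \<phi> b}" n] by simp
    have "\<phi> b \<le> n" if "b \<in> {1..n}" for b
      using PiE_mem[OF \<phi>(1)[unfolded colourings_def] that] by simp
    then have S: "S \<le> n ^ 2" unfolding S_def power2_eq_square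
      using sum_bounded_above[of "{1..n}" \<phi> n] by simp
    have "int K - 2 * int S \<in> {- 2 * int q..int q}" if "K \<le> q" "S \<le> q" for q using that by auto
    then have "int K - 2 * int S \<in> {- 2 * int (n ^ 2)..int (n ^ 2)}" using K S by blast
    moreover have "x = real_of_int (int K - 2 * int S) / 2"
      by (simp add: \<phi>(2) content_def K_def S_def)
    ultimately show "x \<in> (\<lambda>k. real_of_int k / 2) ` {- 2 * int (n ^ 2)..int (n ^ 2)}" by blast
  qed
  then have "card (spec n) \<le> card {- 2 * int (n ^ 2)..int (n ^ 2)}"
    by (meson finite_atLeastAtMost_int surj_card_le)
  moreover have "card {- 2 * int q..int q} = 3 * q + 1" for q by (simp add: nat_eq_iff)
  ultimately show ?thesis by metis
qed

text \<open>The sum factors over the points: colour \<open>0\<close> contributes \<open>1\<close>,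
  each of the \<open>R\<close> other colours \<open>z\<close>.\<close>

lemma sum_power_mass:
  fixes z :: real
  shows "(\<Sum>\<psi>\<in>{1..n} \<rightarrow>\<^sub>E {..R}. z ^ mass n \<psi>) = (1 + real R * z) ^ n"
proof -
  have "z ^ mass n \<psi> = (\<Prod>a\<in>{1..n}. if \<psi> a = 0 then 1 else z)" for \<psi>
    by (subst prod.If_cases) (auto simp: mass_def Int_def)
  then have "(\<Sum>\<psi>\<in>{1..n} \<rightarrow>\<^sub>E {..R}. z ^ mass n \<psi>) = (\<Prod>a\<in>{1..n}. \<Sum>c\<in>{..R}. if c = 0 then 1 else z)"
    by (simp only: prod_sum_PiE finite_atLeastAtMost finite_atMost)
  also have "(\<Sum>c\<in>{..R}. if c = 0 then 1 else z) = 1 + real R * z"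
    by (simp add: sum.atMost_shift)
  finally show ?thesis by simp
qed

text \<open>For fixed \<open>N\<close>, \<open>w ^ k * exp (- w * N)\<close> is maximal at
  \<open>w = k / N\<close>. This trades a power of the mass for an exponential, which can be summed
  over colourings.\<close>

lemma power_le_exp:
  fixes w N :: real
  assumes "w \<ge> 0" "N > 0" "k > 0"
  shows "w ^ k \<le> (real k / (exp 1 * N)) ^ k * exp (w * N)"
proof -
  define z where "z = w * N / real k"
  have "z \<le> exp (z - 1)" using exp_ge_add_one_self[of "z - 1"] by simp
  then have "z ^ k \<le> exp (z - 1) ^ k" by (rule power_mono) (use assms in \<open>simp add: z_def\<close>)
  also have "\<dots> = exp (w * N) / exp 1 ^ k"
    using assms by (simp add: z_def exp_diff power_divide flip: exp_of_nat_mult)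
  finally show ?thesis using assms by (simp add: z_def power_divide power_mult_distrib field_simps)
qed

text \<open>\<open>power_le_exp\<close> with exponent \<open>2 * l\<close> bounds the eigenvalue
  factor, and \<open>sum_power_mass\<close> with \<open>1 + x \<le> exp x\<close> bounds the
  remaining sum. The leading factor counts eigenvalues.\<close>

lemma hurwitz_number_le:
  fixes T N :: real
  assumes l: "even l" "l > 0" and T: "T > 0" and N: "N > 0"
  shows "real (hurwitz_number n l) \<le> (3 * real n ^ 2 + 1) *
    ((2 * real l / (exp 1 * N)) ^ (2 * l) / 2 ^ l * exp (N * sqrt (n * T) + real n ^ 2 * exp (N + 1) / T ^ 2))"
proof -
  let ?E = "{1..n} \<rightarrow>\<^sub>E {..nat \<lfloor>n / T\<rfloor>}"
  let ?w = "\<lambda>\<psi>. real (mass n \<psi>) + sqrt (n * T)"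
  let ?C = "(2 * real l / (exp 1 * N)) ^ (2 * l) / 2 ^ l"
  have finE: "finite ?E" by (rule finite_PiE) auto
  have C0: "?C \<ge> 0" using N by simp
  have bound: "y ^ l * point_component n y id \<le> ?C * exp (N * sqrt (n * T) + real n ^ 2 * exp (N + 1) / T ^ 2)"
    if y: "y \<in> spec n" for y
  proof -
    let ?\<Psi> = "{\<psi> \<in> ?E. \<bar>y\<bar> \<le> (?w \<psi>) ^ 2 / 2}"
    have "y ^ l * point_component n y id = \<bar>y\<bar> ^ l * point_component n y id"
      using l by (simp add: power_even_abs)
    also have "\<dots> \<le> \<bar>y\<bar> ^ l * (\<Sum>\<psi>\<in>?\<Psi>. (exp 1 / T) ^ mass n \<psi>)"
      by (intro mult_left_mono point_component_le y T) simp
    also have "\<dots> = (\<Sum>\<psi>\<in>?\<Psi>. \<bar>y\<bar> ^ l * (exp 1 / T) ^ mass n \<psi>)"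
      by (rule sum_distrib_left)
    also have "\<dots> \<le> (\<Sum>\<psi>\<in>?\<Psi>. ?C * exp (N * sqrt (n * T)) * (exp (N + 1) / T) ^ mass n \<psi>)"
    proof (rule sum_mono)
      fix \<psi> assume \<psi>: "\<psi> \<in> ?\<Psi>"
      have w0: "?w \<psi> \<ge> 0" using T by simp
      have "\<bar>y\<bar> ^ l \<le> ((?w \<psi>) ^ 2 / 2) ^ l" using \<psi> by (intro power_mono) auto
      also have "\<dots> = (?w \<psi>) ^ (2 * l) / 2 ^ l" by (simp add: power_divide power_mult)
      also have "\<dots> \<le> (real (2 * l) / (exp 1 * N)) ^ (2 * l) * exp (?w \<psi> * N) / 2 ^ l"
        using power_le_exp[OF w0 N, of "2 * l"] l by (intro divide_right_mono) auto
      also have "\<dots> = ?C * exp (N * sqrt (n * T)) * exp N ^ mass n \<psi>"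
        by (simp add: algebra_simps exp_add flip: exp_of_nat_mult)
      finally have "\<bar>y\<bar> ^ l * (exp 1 / T) ^ mass n \<psi>
          \<le> ?C * exp (N * sqrt (n * T)) * exp N ^ mass n \<psi> * (exp 1 / T) ^ mass n \<psi>"
        by (rule mult_right_mono) (use T in simp)
      also have "\<dots> = ?C * exp (N * sqrt (n * T)) * (exp (N + 1) / T) ^ mass n \<psi>"
        by (simp add: exp_add power_divide power_mult_distrib)
      finally show "\<bar>y\<bar> ^ l * (exp 1 / T) ^ mass n \<psi>
          \<le> ?C * exp (N * sqrt (n * T)) * (exp (N + 1) / T) ^ mass n \<psi>" .
    qed
    \<comment> \<open>The eigenvalue is gone and the terms are nonnegative, so the sum may run over
      all colourings, where it factors.\<close>
    also have "\<dots> \<le> (\<Sum>\<psi>\<in>?E. ?C * exp (N * sqrt (n * T)) * (exp (N + 1) / T) ^ mass n \<psi>)"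
      by (rule sum_mono2) (use finE C0 T in auto)
    also have "\<dots> = ?C * exp (N * sqrt (n * T)) * (1 + real (nat \<lfloor>n / T\<rfloor>) * (exp (N + 1) / T)) ^ n"
      unfolding sum_distrib_left[symmetric] sum_power_mass ..
    also have "\<dots> \<le> ?C * exp (N * sqrt (n * T)) * exp (real n ^ 2 * exp (N + 1) / T ^ 2)"
    proof (rule mult_left_mono)
      have "real (nat \<lfloor>n / T\<rfloor>) \<le> n / T" using T by (intro of_nat_floor) simp
      then have "real (nat \<lfloor>n / T\<rfloor>) * (exp (N + 1) / T) \<le> n / T * (exp (N + 1) / T)"
        using T by (intro mult_right_mono) auto
      moreover have "1 + n / T * (exp (N + 1) / T) \<le> exp (n / T * (exp (N + 1) / T))"
        by (rule exp_ge_add_one_self)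
      ultimately have "1 + real (nat \<lfloor>n / T\<rfloor>) * (exp (N + 1) / T) \<le> exp (n / T * (exp (N + 1) / T))"
        by linarith
      then have "(1 + real (nat \<lfloor>n / T\<rfloor>) * (exp (N + 1) / T)) ^ n \<le> exp (n / T * (exp (N + 1) / T)) ^ n"
        by (rule power_mono) (use T in simp)
      also have "\<dots> = exp (real n ^ 2 * exp (N + 1) / T ^ 2)"
        by (simp add: power2_eq_square flip: exp_of_nat_mult)
      finally show "(1 + real (nat \<lfloor>n / T\<rfloor>) * (exp (N + 1) / T)) ^ n \<le> exp (real n ^ 2 * exp (N + 1) / T ^ 2)" .
    qed (use C0 in simp)
    finally show ?thesis by (simp add: exp_add mult.assoc)
  qed
  have "real (hurwitz_number n l) \<le> real (card (spec n)) * (?C * exp (N * sqrt (n * T) + real n ^ 2 * exp (N + 1) / T ^ 2))"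
    unfolding hurwitz_number_spectral using bound by (rule sum_bounded_above)
  also have "\<dots> \<le> (3 * real n ^ 2 + 1) * (?C * exp (N * sqrt (n * T) + real n ^ 2 * exp (N + 1) / T ^ 2))"
  proof (rule mult_right_mono)
    show "real (card (spec n)) \<le> 3 * real n ^ 2 + 1"
      using of_nat_mono[OF card_spec_le[of n], where 'a = real] by simp
  qed (use C0 in simp)
  finally show ?thesis .
qed

section \<open>Lower bound from the constant functions\<close>

lemma hurwitz_number_mono: "m \<le> n \<Longrightarrow> hurwitz_number m l \<le> hurwitz_number n l"
proof -
  assume "m \<le> n"
  then have "transpositions m \<subseteq> transpositions n" unfolding transpositions_def by fastforce
  moreover have "finite {ts. length ts = l \<and> set ts \<subseteq> transpositions n \<and> foldr (\<circ>) ts id = id}"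
    by (rule finite_subset[OF _ finite_lists_length_eq[OF finite_transpositions, of n l]]) auto
  ultimately show ?thesis unfolding hurwitz_number_def by (intro card_mono) auto
qed

text \<open>The constant function has eigenvalue \<open>m choose 2\<close>, and Cauchy-Schwarz
  bounds the component of the point mass there below by \<open>1 / fact m\<close> at the identity.
  For even \<open>l\<close> the other spectral terms are nonnegative.\<close>

lemma hurwitz_number_ge:
  assumes l: "even l"
  shows "(real m * (real m - 1) / 2) ^ l / fact m \<le> real (hurwitz_number m l)"
proof -
  define c where "c = real m * (real m - 1) / 2"
  define u where "u = (\<lambda>s. if s \<in> perms m then 1 else 0 :: real)"
  have u: "eigen m c u"
    unfolding eigen_def
  proof (intro conjI allI)
    show "supported m u" by (simp add: supported_def u_def)
    fix s
    have "2 * walk m u s = (\<Sum>b\<in>{1..m}. \<Sum>a\<in>{1..m} - {b}. u s)"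
      unfolding walk_pairs u_def by (intro sum.cong refl) auto
    also have "\<dots> = (\<Sum>b\<in>{1..m}. (real m - 1) * u s)"
      by (intro sum.cong refl) (simp add: of_nat_diff)
    finally show "walk m u s = c * u s" by (simp add: c_def)
  qed
  have "\<exists>\<phi>\<in>colourings m. content m \<phi> = c \<and> (\<exists>s. symmetrise m \<phi> u s \<noteq> 0)"
    using u by (rule eigenvalue_content[where s = id]) (simp add: u_def)
  then have c: "c \<in> spec m" by (auto simp: spec_def)
  let ?e = "point_component m c"
  have "1 = ip m u (point id)" by (subst ip_point) (simp_all add: u_def)
  also have "\<dots> = ip m u ?e"
    by (rule ip_component[OF point_component c u])
  finally have "1 = (ip m u ?e) ^ 2" by simp
  also have "\<dots> \<le> ip m u u * ip m ?e ?e"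
    unfolding ip_def using Cauchy_Schwarz_ineq_sum[of u ?e "perms m"] by (simp add: power2_eq_square)
  also have "ip m u u = fact m" by (simp add: ip_def u_def card_perms)
  also have "ip m ?e ?e = ?e id" using point_component_id[OF c] by simp
  finally have e: "1 / fact m \<le> ?e id" by (simp add: field_simps)
  have "c ^ l * (1 / fact m) \<le> c ^ l * ?e id"
    by (intro mult_left_mono e zero_le_even_power l)
  also have "\<dots> \<le> (\<Sum>x\<in>spec m. x ^ l * point_component m x id)"
    by (rule member_le_sum) (use c l in \<open>auto intro!: mult_nonneg_nonneg point_component_nonneg zero_le_even_power\<close>)
  finally show ?thesis unfolding hurwitz_number_spectral by (simp add: c_def)
qed

section \<open>Asymptotics\<close>

text \<open>The logarithm of the Hurwitz number minus that of the claimed main term.\<close>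

definition error_term :: "nat \<Rightarrow> nat \<Rightarrow> real" where
  "error_term n l = ln (real (hurwitz_number n l))
     - 2 * real l * (ln (real l) - ln (ln (real n))) + 2 * real l - real l * ln 2"

lemma hurwitz_number_pos:
  assumes "even l" "n \<ge> 2" shows "hurwitz_number n l > 0"
proof -
  \<comment> \<open>At \<open>m = 2\<close> the lower bound is \<open>1 / 2\<close>.\<close>
  have "0 < (real 2 * (real 2 - 1) / 2) ^ l / fact 2" by simp
  also have "\<dots> \<le> real (hurwitz_number 2 l)" by (rule hurwitz_number_ge[OF assms(1)])
  also have "\<dots> \<le> real (hurwitz_number n l)" using hurwitz_number_mono[OF assms(2)] by simp
  finally show ?thesis by simp
qed

lemma hurwitz_number_error_term:
  assumes "even l" "n \<ge> 2"
  shows "real (hurwitz_number n l)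
    = (real l / ln (real n)) ^ (2 * l) * exp ((- 2 + ln 2) * real l + error_term n l)"
proof (cases "l = 0")
  \<comment> \<open>At \<open>l = 0\<close> the base is \<open>0\<close>, not the exponential of its
    logarithm, but the power is \<open>1\<close>.\<close>
  case True
  then show ?thesis using hurwitz_number_pos[OF assms] by (simp add: error_term_def)
next
  case False
  have n: "ln (real n) > 0" using assms by simp
  have "(real l / ln (real n)) ^ (2 * l) = exp (ln (real l / ln (real n))) ^ (2 * l)"
    using False n by simp
  also have "\<dots> = exp (2 * real l * (ln (real l) - ln (ln (real n))))"
    using False n by (simp add: ln_div flip: exp_of_nat_mult)
  finally have "(real l / ln (real n)) ^ (2 * l) * exp ((- 2 + ln 2) * real l + error_term n l)
      = exp (2 * real l * (ln (real l) - ln (ln (real n))) + ((- 2 + ln 2) * real l + error_term n l))"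
    by (simp only: exp_add)
  also have "\<dots> = exp (ln (real (hurwitz_number n l)))"
    by (simp add: error_term_def algebra_simps)
  finally show ?thesis using hurwitz_number_pos[OF assms] by simp
qed

text \<open>With \<open>T = n / (ln n)\<^sup>4\<close> and \<open>N = ln n - 12 ln (ln n)\<close> both terms in the exponent of
  \<open>hurwitz_number_le\<close> are \<open>o(n)\<close>, while \<open>N\<close> is still asymptotic to \<open>ln n\<close>.\<close>

lemma error_term_le:
  fixes b :: real
  assumes l: "even l" "l > 0" "real l \<le> b * n" and n: "n \<ge> 3"
    and N: "ln n - 12 * ln (ln n) > 0"
  shows "error_term n l \<le> n * (ln (3 * real n ^ 2 + 1) / n
      + 2 * b * (ln (ln n) - ln (ln n - 12 * ln (ln n)))
      + (ln n - 12 * ln (ln n)) / ln n ^ 2 + exp 1 / ln n ^ 4)"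
proof -
  define q where "q = ln (real n)"
  define N where "N = q - 12 * ln q"
  define T where "T = real n / q ^ 4"
  have "exp 1 \<le> real n" using exp_le n by linarith
  then have "q \<ge> 1" using n unfolding q_def by (subst ln_ge_iff) auto
  then have q1: "q \<ge> 1" "q > 0" by auto
  have T0: "T > 0" using n q1 by (simp add: T_def)
  have N0: "N > 0" using N by (simp add: N_def q_def)
  have sq: "sqrt (real n * T) = n / q ^ 2"
  proof -
    have "real n * T = (n / q ^ 2) ^ 2" by (simp add: T_def power2_eq_square power4_eq_xxxx)
    then show ?thesis using q1 by simp
  qed
  have "exp N = n / q ^ 12"
  proof -
    have "exp N = exp q / exp (ln q) ^ 12" by (simp add: N_def exp_diff flip: exp_of_nat_mult)
    then show ?thesis using q1 n by (simp add: q_def)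
  qed
  \<comment> \<open>\<open>T ^ 2\<close> brings in \<open>q ^ 8\<close> and \<open>exp N\<close> the
    divisor \<open>q ^ 12\<close>, so \<open>q ^ 4\<close> remains in the denominator.\<close>
  then have ex: "real n ^ 2 * exp (N + 1) / T ^ 2 = exp 1 * n / q ^ 4"
    using q1 n by (simp add: T_def exp_add power_divide field_simps power_mult[symmetric] flip: power_add)
  let ?C = "(2 * real l / (exp 1 * N)) ^ (2 * l) / 2 ^ l"
  have H0: "real (hurwitz_number n l) > 0" using hurwitz_number_pos[OF l(1)] n by simp
  have "real (hurwitz_number n l) \<le> (3 * real n ^ 2 + 1) * (?C * exp (N * (n / q ^ 2) + exp 1 * n / q ^ 4))"
    using hurwitz_number_le[OF l(1,2) T0 N0, of n] unfolding sq ex .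
  then have "ln (real (hurwitz_number n l)) \<le> ln ((3 * real n ^ 2 + 1) * (?C * exp (N * (n / q ^ 2) + exp 1 * n / q ^ 4)))"
    using H0 by (intro ln_mono)
  also have "\<dots> = ln (3 * real n ^ 2 + 1) + (ln ?C + (N * (n / q ^ 2) + exp 1 * n / q ^ 4))"
  proof -
    have "3 * real n ^ 2 + 1 > 0" "?C > 0" using l N0 by (auto intro: add_nonneg_pos)
    moreover have "ln (u * (v * exp w)) = ln u + (ln v + w)" if "u > 0" "v > 0" for u v w :: real
      using that by (simp add: ln_mult)
    ultimately show ?thesis by blast
  qed
  also have "ln ?C = 2 * l * (ln 2 + ln l - 1 - ln N) - l * ln 2"
    using l N0 by (simp add: ln_div ln_mult ln_realpow)
  finally have "error_term n l \<le> ln (3 * real n ^ 2 + 1) + 2 * l * (ln q - ln N) + (N * (n / q ^ 2) + exp 1 * n / q ^ 4)"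
    unfolding error_term_def q_def[symmetric] by (simp add: algebra_simps)
  \<comment> \<open>Since \<open>N \<le> q\<close>, the bracket is nonnegative and \<open>l\<close>
    can be replaced by its upper bound.\<close>
  also have "2 * l * (ln q - ln N) \<le> 2 * (b * n) * (ln q - ln N)"
  proof (intro mult_right_mono)
    have "N \<le> q" using q1 by (simp add: N_def)
    then show "0 \<le> ln q - ln N" using N0 q1 by simp
  qed (use l in auto)
  finally show ?thesis using n unfolding N_def q_def distrib_left by (simp add: mult_ac)
qed

text \<open>On \<open>m\<close> about \<open>2 * l / ln n\<close> letters,
  \<open>fact m \<le> n ^ m \<le> exp (2 * l)\<close> costs the \<open>- 2 * l\<close> of the main
  term, and rounding costs the logarithm. \<open>2 * b \<le> ln n\<close> ensures
  \<open>m \<le> n\<close>; \<open>ln n < a * n\<close> keeps the argument of \<open>ln\<close>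
  positive.\<close>

lemma error_term_ge:
  fixes a b :: real
  assumes l: "even l" "a * n \<le> real l" "real l \<le> b * n" and n: "n \<ge> 3"
    and a: "a > 0" and b: "2 * b \<le> ln n" and an: "ln n < a * n"
  shows "n * (2 * b * ln (1 - ln n / (a * n))) \<le> error_term n l"
proof -
  define q where "q = ln (real n)"
  have q0: "q > 0" using n by (simp add: q_def)
  have an0: "a * n > 0" using a n by simp
  have l0: "real l > q" using l an by (simp add: q_def)
  define m where "m = nat \<lfloor>2 * l / q\<rfloor>"
  have m1: "real m \<le> 2 * l / q" using q0 unfolding m_def by (intro of_nat_floor) simp
  \<comment> \<open>Rounding down loses less than \<open>1\<close>, and the factor
    \<open>m - 1\<close> loses one more.\<close>
  have m2: "2 * l / q - 2 < real m - 1" using q0 unfolding m_def by linarith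
  have m3: "2 * l / q - 2 > 0" using l0 q0 by (simp add: field_simps)
  have "2 * l / q \<le> n"
  proof -
    have "2 * real l \<le> (2 * b) * n" using l by simp
    also have "\<dots> \<le> q * n" using b by (intro mult_right_mono) (auto simp: q_def)
    finally show ?thesis using q0 by (simp add: field_simps)
  qed
  then have mn: "m \<le> n" using m1 by linarith
  have "((2 * l / q - 2) ^ 2 / 2) ^ l / exp (2 * l) \<le> (real m * (real m - 1) / 2) ^ l / fact m"
  proof (rule frac_le)
    show "((2 * l / q - 2) ^ 2 / 2) ^ l \<le> (real m * (real m - 1) / 2) ^ l"
    proof (rule power_mono)
      have "(2 * l / q - 2) * (2 * l / q - 2) \<le> real m * (real m - 1)"
        using m2 m3 by (intro mult_mono) auto
      then show "(2 * l / q - 2) ^ 2 / 2 \<le> real m * (real m - 1) / 2" by (simp add: power2_eq_square)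
    qed simp
    have "fact m \<le> real m ^ m" using fact_le_power[of m, where 'a = real] by simp
    also have "\<dots> \<le> real n ^ m" using mn by (intro power_mono) auto
    also have "\<dots> = exp (m * q)" using n by (simp add: exp_of_nat_mult q_def)
    also have "\<dots> \<le> exp (2 * l)" using m1 q0 by (simp add: field_simps)
    finally show "fact m \<le> exp (2 * l)" .
    show "0 \<le> (real m * (real m - 1) / 2) ^ l" using l by (intro zero_le_even_power)
  qed simp
  also have "\<dots> \<le> real (hurwitz_number m l)" by (rule hurwitz_number_ge[OF l(1)])
  also have "\<dots> \<le> real (hurwitz_number n l)" using hurwitz_number_mono[OF mn] by simp
  finally have H: "((2 * l / q - 2) ^ 2 / 2) ^ l / exp (2 * l) \<le> real (hurwitz_number n l)" .
  have "2 * l / q - 2 = 2 * l / q * (1 - q / l)" using q0 l0 by (simp add: field_simps)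
  moreover have "1 - q / l > 0" using q0 l0 by simp
  moreover have "2 * l / q > 0" using q0 l0 by simp
  ultimately have lnm: "ln (2 * l / q - 2) = ln 2 + ln l - ln q + ln (1 - q / l)"
    using q0 l0 by (simp add: ln_mult ln_div)
  have "ln (((2 * l / q - 2) ^ 2 / 2) ^ l / exp (2 * l)) = l * (2 * ln (2 * l / q - 2) - ln 2) - 2 * l"
    using m3 by (simp add: ln_div ln_realpow)
  moreover have "ln (((2 * l / q - 2) ^ 2 / 2) ^ l / exp (2 * l)) \<le> ln (real (hurwitz_number n l))"
    using H m3 by (intro ln_mono) auto
  ultimately have "l * (2 * (ln 2 + ln l - ln q + ln (1 - q / l)) - ln 2) - 2 * l \<le> ln (real (hurwitz_number n l))"
    unfolding lnm by simp
  then have E: "2 * l * ln (1 - q / l) \<le> error_term n l"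
    unfolding error_term_def q_def[symmetric] by (simp add: algebra_simps)
  have r: "0 < 1 - q / (a * n)" using an an0 by (simp add: q_def)
  \<comment> \<open>The logarithm is nonpositive, so the upper bound on \<open>l\<close> yields a
    lower bound.\<close>
  have "(b * n) * ln (1 - q / (a * n)) \<le> l * ln (1 - q / (a * n))"
    by (rule mult_right_mono_neg) (use l r q0 an0 in auto)
  also have "\<dots> \<le> l * ln (1 - q / l)"
  proof (intro mult_left_mono ln_mono)
    have "q / l \<le> q / (a * n)" using l q0 an0 by (intro divide_left_mono) auto
    then show "1 - q / (a * n) \<le> 1 - q / l" by simp
  qed (use r in auto)
  finally show ?thesis using E unfolding q_def by (simp add: algebra_simps)
qed

section \<open>Uniform smallness of the error\<close>

lemma error_term_uniform:
  fixes a b \<epsilon> :: real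
  assumes a: "a > 0" and e: "\<epsilon> > 0"
  shows "\<forall>\<^sub>F n in sequentially. \<forall>l. even l \<longrightarrow> a * n \<le> real l \<longrightarrow> real l \<le> b * n \<longrightarrow> \<bar>error_term n l\<bar> \<le> \<epsilon> * n"
proof -
  \<comment> \<open>After division by \<open>n\<close> the upper and lower bounds depend only on
    \<open>n\<close>, \<open>a\<close> and \<open>b\<close> and tend to \<open>0\<close>; this gives
    uniformity in \<open>l\<close>.\<close>
  have "((\<lambda>n::nat. ln (3 * real n ^ 2 + 1) / n + 2 * b * (ln (ln n) - ln (ln n - 12 * ln (ln n)))
      + (ln n - 12 * ln (ln n)) / ln n ^ 2 + exp 1 / ln n ^ 4) \<longlongrightarrow> 0 + 2 * b * 0 + 0 + 0) sequentially"
    by (intro tendsto_add tendsto_mult tendsto_const; real_asymp)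
  then have up: "\<forall>\<^sub>F n::nat in sequentially. ln (3 * real n ^ 2 + 1) / n
      + 2 * b * (ln (ln n) - ln (ln n - 12 * ln (ln n)))
      + (ln n - 12 * ln (ln n)) / ln n ^ 2 + exp 1 / ln n ^ 4 < \<epsilon>"
    by (rule order_tendstoD) (use e in simp)
  have "((\<lambda>n::nat. 2 * b * ln (1 - ln n / (a * n))) \<longlongrightarrow> 2 * b * 0) sequentially"
    using a by (intro tendsto_mult tendsto_const) real_asymp
  then have lo: "\<forall>\<^sub>F n::nat in sequentially. 2 * b * ln (1 - ln n / (a * n)) > - \<epsilon>"
    by (rule order_tendstoD) (use e in simp)
  have N: "\<forall>\<^sub>F n::nat in sequentially. ln n - 12 * ln (ln n) > 0" by real_asymp
  have B: "\<forall>\<^sub>F n::nat in sequentially. 2 * b \<le> ln n" by real_asymp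
  have A: "\<forall>\<^sub>F n::nat in sequentially. ln n < a * n" using a by real_asymp
  show ?thesis
    using up lo N B A eventually_ge_at_top[of 3]
  proof eventually_elim
    case (elim n)
    show ?case
    proof (intro allI impI)
      fix l :: nat assume l: "even l" "a * n \<le> real l" "real l \<le> b * n"
      have "0 < a * n" using a elim(6) by simp
      then have l0: "l > 0" using l(2) by linarith
      have "error_term n l \<le> n * (ln (3 * real n ^ 2 + 1) / n
          + 2 * b * (ln (ln n) - ln (ln n - 12 * ln (ln n)))
          + (ln n - 12 * ln (ln n)) / ln n ^ 2 + exp 1 / ln n ^ 4)"
        by (rule error_term_le[OF l(1) l0 l(3) elim(6) elim(3)])
      also have "\<dots> \<le> n * \<epsilon>" using elim(1) by (intro mult_left_mono) auto
      finally have 1: "error_term n l \<le> \<epsilon> * n" by (simp add: mult.commute)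
      have "n * (- \<epsilon>) \<le> n * (2 * b * ln (1 - ln n / (a * n)))"
        using elim(2) by (intro mult_left_mono) auto
      also have "\<dots> \<le> error_term n l"
        by (rule error_term_ge[OF l elim(6) a elim(4,5)])
      finally show "\<bar>error_term n l\<bar> \<le> \<epsilon> * n" using 1 by (simp add: abs_le_iff mult.commute)
    qed
  qed
qed

text \<open>One error function \<open>E\<close> is fixed before \<open>\<theta>\<close>, the
  sequence \<open>l\<close> and \<open>K\<close>, so the same term serves the sequential and the
  uniform claim.\<close>

theorem theorem1p4:
  "\<exists>E :: nat \<Rightarrow> nat \<Rightarrow> real.
     (\<forall>\<^sub>F n in sequentially. \<forall>l. even l \<longrightarrow>
        real (hurwitz_number n l) =
          (real l / ln (real n)) ^ (2 * l) * exp ((- 2 + ln 2) * real l + E n l)) \<and>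
     (\<forall>(\<theta>::real) (l :: nat \<Rightarrow> nat). \<theta> > 0 \<longrightarrow> (\<forall>n. even (l n)) \<longrightarrow>
        (\<lambda>n. real (l n)) \<sim>[sequentially] (\<lambda>n. 2 * \<theta> * real n) \<longrightarrow>
        (\<lambda>n. E n (l n)) \<in> o[sequentially](\<lambda>n. real n)) \<and>
     (\<forall>K :: real set. compact K \<longrightarrow> K \<subseteq> {0<..} \<longrightarrow>
        (\<forall>\<epsilon>>0. \<forall>\<^sub>F n in sequentially. \<forall>l. even l \<longrightarrow> real l / real n \<in> K \<longrightarrow>
           \<bar>E n l\<bar> \<le> \<epsilon> * real n))"
proof (intro exI[of _ error_term] conjI allI impI)
  show "\<forall>\<^sub>F n in sequentially. \<forall>l. even l \<longrightarrow> real (hurwitz_number n l) =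
      (real l / ln (real n)) ^ (2 * l) * exp ((- 2 + ln 2) * real l + error_term n l)"
    using eventually_ge_at_top[of 2] by eventually_elim (use hurwitz_number_error_term in blast)
next
  fix \<theta> :: real and l :: "nat \<Rightarrow> nat"
  assume \<theta>: "\<theta> > 0" and l: "\<forall>n. even (l n)"
    and asy: "(\<lambda>n. real (l n)) \<sim>[sequentially] (\<lambda>n. 2 * \<theta> * real n)"
  have "((\<lambda>n. real (l n) / (2 * \<theta> * real n)) \<longlongrightarrow> 1) sequentially"
  proof (rule asymp_equivD_strong[OF asy])
    show "\<forall>\<^sub>F n in sequentially. real (l n) \<noteq> 0 \<or> 2 * \<theta> * real n \<noteq> 0"
      using eventually_gt_at_top[of 0] by eventually_elim (use \<theta> in simp)
  qed
  \<comment> \<open>These ratios put \<open>l n\<close> between \<open>\<theta> * n\<close> and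
    \<open>3 * \<theta> * n\<close>, where the uniform bound applies.\<close>
  then have lim: "\<forall>\<^sub>F n in sequentially. real (l n) / (2 * \<theta> * real n) > 1 / 2"
      "\<forall>\<^sub>F n in sequentially. real (l n) / (2 * \<theta> * real n) < 3 / 2"
    by (rule order_tendstoD; simp)+
  show "(\<lambda>n. error_term n (l n)) \<in> o[sequentially](\<lambda>n. real n)"
  proof (rule landau_o.smallI)
    fix c :: real assume "c > 0"
    from error_term_uniform[OF \<theta> this, of "3 * \<theta>"] lim eventually_gt_at_top[of 0]
    show "\<forall>\<^sub>F n in sequentially. norm (error_term n (l n)) \<le> c * norm (real n)"
    proof eventually_elim
      case (elim n)
      then have "\<theta> * n \<le> real (l n)" "real (l n) \<le> 3 * \<theta> * n"
        using \<theta> by (simp_all add: field_simps)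
      then show ?case using elim(1) l by simp
    qed
  qed
next
  fix K :: "real set" and \<epsilon> :: real
  assume K: "compact K" "K \<subseteq> {0<..}" and \<epsilon>: "\<epsilon> > 0"
  show "\<forall>\<^sub>F n in sequentially. \<forall>l. even l \<longrightarrow> real l / real n \<in> K \<longrightarrow> \<bar>error_term n l\<bar> \<le> \<epsilon> * real n"
  proof (cases "K = {}")
    case False
    \<comment> \<open>The least and greatest elements of \<open>K\<close> bound
      \<open>l / n\<close>; the least is positive because \<open>K\<close> lies in the positive
      reals.\<close>
    obtain a where a: "a \<in> K" "\<And>x. x \<in> K \<Longrightarrow> a \<le> x" using compact_attains_inf[OF K(1) False] by blast
    obtain b where b: "b \<in> K" "\<And>x. x \<in> K \<Longrightarrow> x \<le> b" using compact_attains_sup[OF K(1) False] by blast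
    have "a > 0" using a K by auto
    from error_term_uniform[OF this \<epsilon>, of b] eventually_gt_at_top[of 0] show ?thesis
    proof eventually_elim
      case (elim n)
      show ?case
      proof (intro allI impI)
        fix l assume l: "even l" "real l / real n \<in> K"
        then have "a * n \<le> real l" "real l \<le> b * n"
          using a(2)[OF l(2)] b(2)[OF l(2)] elim(2) by (simp_all add: field_simps)
        then show "\<bar>error_term n l\<bar> \<le> \<epsilon> * real n" using elim(1) l by blast
      qed
    qed
  qed simp
qed

end
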